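(* Let $d\ge1$ and let $\mathbf y=(y_w)_{w\in\mathcal W_{2d}}$, $y_w\in\mathbb H$, be a truncated quaternionic pseudo-moment sequence with $y_1=1$, $\mathbf M_d(\mathbf y)\succeq0$ and $\operatorname{rank}_{\mathbb H}\mathbf M_d(\mathbf y)=\operatorname{rank}_{\mathbb H}\mathbf M_{d-1}(\mathbf y)=r$. Let $(\mathscr H,\pi,\xi)$ be its canonical flat representation and $\mathscr R=\pi(\mathcal F_n)$. Let $F_1,\dots,F_s$ be any real vector-space basis of $\mathscr R$. The following conditions are equivalent: (i) $\pi(\mathcal I_n^{\mathbb R})=0$; (ii) $\operatorname{Sym}\mathscr R\subseteq Z(\mathscr R)$; (iii) $[F_a+F_a^*,F_b]=0$ for $a,b=1,\dots,s$; (iv) $[F_a+F_a^*,\pi(q_i)]=0$ for $a=1,\dots,s$, $i=1,\dots,n$. Consequently, scalar consistency (condition (i)) can be verified by finitely many tests. Moreover, $s\le\dim_{\mathbb R}B_{\mathbb H}(\mathscr H)=4r^2$.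
   Context: $\mathbb H$ is the skew field of quaternions, $\mathcal R(a)$ the real part. Fix $n\ge1$ and letters $q_1,\dots,q_n,\bar q_1,\dots,\bar q_n$. $\mathcal W$ is the set of words (including the empty word $1$) in these letters; $|w|$ is the length, $\mathcal W_t$ the words of length at most $t$; $w^*$ is obtained by reversing $w$ and exchanging $q_i\leftrightarrow\bar q_i$. $\mathcal F_n=\mathbb R\langle\mathbf q,\bar{\mathbf q}\rangle$ is the free real $*$-algebra spanned by words. $\mathcal I_n^{\mathbb R}$ is the ideal of all $p\in\mathcal F_n$ vanishing under every evaluation $q_i\mapsto a_i$, $\bar q_i\mapsto\bar a_i$, $\mathbf a\in\mathbb H^n$. Every word has a normal form $\prod_i|q_i|^{2\alpha_i}\tilde w$ obtained by writing consecutive factors $q_i\bar q_i$ or $\bar q_iq_i$ as $|q_i|^2$ and moving them to the front until $\tilde w$ contains no such factor; moments $y_w$ depend only on the normal form of $w$. Words $u,v$ are cyclically equivalent if $u=w_1w_2$, $v=w_2w_1$ for some words. $\mathbf y=(y_w)_{w\in\mathcal W_{2d}}$ is a truncated quaternionic pseudo-moment sequence if $y_w=\overline{y_{w^*}}$ for $w\in\mathcal W_{2d}$ and $\mathcal R(y_u)=\mathcal R(y_v)$ for cyclically equivalent $u,v\in\mathcal W_{2d}$. $[\mathbf M_t(\mathbf y)]_{u,v}=y_{u^*v}$, $u,v\in\mathcal W_t$, $t\le d$; $\succeq0$ means Hermitian with nonnegative quadratic form on quaternionic vectors; $\operatorname{rank}_{\mathbb H}$ is the quaternionic (right column) rank.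 Canonical flat representation. Choose vectors $\boldsymbol v_w$, $w\in\mathcal W_d$, spanning a right quaternionic Hilbert space $\mathscr H$ of $\mathbb H$-dimension $r$ (inner product conjugate-linear in the first, right-linear in the second argument) with $\langle\boldsymbol v_u,\boldsymbol v_v\rangle=y_{u^*v}$. By flatness $\mathscr H=\operatorname{span}_{\mathbb H}\{\boldsymbol v_w:w\in\mathcal W_{d-1}\}$. For each letter $a$, the rule $X_a\boldsymbol v_w=\boldsymbol v_{aw}$ ($w\in\mathcal W_{d-1}$) gives a well-defined right-$\mathbb H$-linear operator on $\mathscr H$, with $X_{a^*}=X_a^*$. $\pi:\mathcal F_n\to B_{\mathbb H}(\mathscr H)$ (right-$\mathbb H$-linear operators) is the unital real $*$-representation with $\pi(a_1\cdots a_m)=X_{a_1}\cdots X_{a_m}$ for letters $a_s$, and $\xi=\boldsymbol v_1$. $\operatorname{Sym}\mathscr R=\{A\in\mathscr R:A^*=A\}$, $Z(\mathscr R)$ is the center of $\mathscr R$, $[A,B]$ is the commutator. *)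

theory Defs
  imports Complex_Main "HOL-Library.Poly_Mapping" "HOL-Library.Function_Algebras"
begin

datatype quat = Quat (qRe: real) (qI: real) (qJ: real) (qK: real)

lemma quat_eq_iff: "p = q \<longleftrightarrow> qRe p = qRe q \<and> qI p = qI q \<and> qJ p = qJ q \<and> qK p = qK q"
  by (cases p; cases q) simp

instantiation quat :: real_div_algebra
begin

definition "0 = Quat 0 0 0 0"
definition "1 = Quat 1 0 0 0"
definition "p + q = Quat (qRe p + qRe q) (qI p + qI q) (qJ p + qJ q) (qK p + qK q)"
definition "- p = Quat (- qRe p) (- qI p) (- qJ p) (- qK p)"
definition "p - q = Quat (qRe p - qRe q) (qI p - qI q) (qJ p - qJ q) (qK p - qK q)"
definition "p * q = Quat
  (qRe p * qRe q - qI p * qI q - qJ p * qJ q - qK p * qK q)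
  (qRe p * qI q + qI p * qRe q + qJ p * qK q - qK p * qJ q)
  (qRe p * qJ q - qI p * qK q + qJ p * qRe q + qK p * qI q)
  (qRe p * qK q + qI p * qJ q - qJ p * qI q + qK p * qRe q)"
definition "c *\<^sub>R q = Quat (c * qRe q) (c * qI q) (c * qJ q) (c * qK q)"
definition "inverse q =
  (let s = (qRe q)\<^sup>2 + (qI q)\<^sup>2 + (qJ q)\<^sup>2 + (qK q)\<^sup>2
   in Quat (qRe q / s) (- qI q / s) (- qJ q / s) (- qK q / s))"
definition "p div q = p * inverse (q :: quat)"

lemma quat_sel_simps [simp]:
  "qRe (0::quat) = 0" "qI (0::quat) = 0" "qJ (0::quat) = 0" "qK (0::quat) = 0"
  "qRe (1::quat) = 1" "qI (1::quat) = 0" "qJ (1::quat) = 0" "qK (1::quat) = 0"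
  "qRe (p + q) = qRe p + qRe q" "qI (p + q) = qI p + qI q"
  "qJ (p + q) = qJ p + qJ q" "qK (p + q) = qK p + qK q"
  "qRe (- p) = - qRe p" "qI (- p) = - qI p" "qJ (- p) = - qJ p" "qK (- p) = - qK p"
  "qRe (p - q) = qRe p - qRe q" "qI (p - q) = qI p - qI q"
  "qJ (p - q) = qJ p - qJ q" "qK (p - q) = qK p - qK q"
  "qRe (p * q) = qRe p * qRe q - qI p * qI q - qJ p * qJ q - qK p * qK q"
  "qI (p * q) = qRe p * qI q + qI p * qRe q + qJ p * qK q - qK p * qJ q"
  "qJ (p * q) = qRe p * qJ q - qI p * qK q + qJ p * qRe q + qK p * qI q"
  "qK (p * q) = qRe p * qK q + qI p * qJ q - qJ p * qI q + qK p * qRe q"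
  "qRe (c *\<^sub>R q) = c * qRe q" "qI (c *\<^sub>R q) = c * qI q"
  "qJ (c *\<^sub>R q) = c * qJ q" "qK (c *\<^sub>R q) = c * qK q"
  for p q :: quat and c :: real
  by (simp_all add: zero_quat_def one_quat_def plus_quat_def uminus_quat_def
      minus_quat_def times_quat_def scaleR_quat_def)

instance
proof
  fix a b c :: quat and x y :: real
  let ?s = "(qRe a)\<^sup>2 + (qI a)\<^sup>2 + (qJ a)\<^sup>2 + (qK a)\<^sup>2"
  show "a * b * c = a * (b * c)"
    by (simp add: quat_eq_iff algebra_simps)
  show "inverse a * a = 1" "a * inverse a = 1" if "a \<noteq> 0"
  proof -
    have s: "?s \<noteq> 0"
      using that by (auto simp: quat_eq_iff add_nonneg_eq_0_iff)
    then obtain z where z: "z * ?s = 1"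
        and inv: "inverse a = z *\<^sub>R Quat (qRe a) (- qI a) (- qJ a) (- qK a)"
      by (intro that[of "inverse ?s"])
        (simp_all add: inverse_quat_def Let_def quat_eq_iff divide_inverse mult.commute)
    show "inverse a * a = 1" "a * inverse a = 1"
      using z unfolding inv by (simp_all add: quat_eq_iff power2_eq_square algebra_simps)
  qed
  show "inverse (0 :: quat) = 0"
    by (simp add: inverse_quat_def quat_eq_iff)
  show "a div b = a * inverse b"
    by (simp add: divide_quat_def)
qed (simp_all add: quat_eq_iff algebra_simps)

end

definition qcnj :: "quat \<Rightarrow> quat" where
  "qcnj q = Quat (qRe q) (- qI q) (- qJ q) (- qK q)"

class rquat_space = ab_group_add +
  fixes qscale :: "'a \<Rightarrow> quat \<Rightarrow> 'a" (infixl "*\<^sub>H" 75)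
  assumes qscale_add_left: "(x + y) *\<^sub>H a = x *\<^sub>H a + y *\<^sub>H a"
    and qscale_add_right: "x *\<^sub>H (a + b) = x *\<^sub>H a + x *\<^sub>H b"
    and qscale_qscale: "x *\<^sub>H a *\<^sub>H b = x *\<^sub>H (a * b)"
    and qscale_one: "x *\<^sub>H 1 = x"

instantiation quat :: rquat_space
begin
definition qscale_quat :: "quat \<Rightarrow> quat \<Rightarrow> quat" where "qscale_quat x a = x * a"
instance by standard (simp_all add: qscale_quat_def algebra_simps)
end

instantiation "fun" :: (type, rquat_space) rquat_space
begin
definition qscale_fun :: "('a \<Rightarrow> 'b) \<Rightarrow> quat \<Rightarrow> 'a \<Rightarrow> 'b" where "qscale_fun f a = (\<lambda>i. f i *\<^sub>H a)"
instance
  by standard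
    (simp_all add: qscale_fun_def fun_eq_iff qscale_add_left qscale_add_right qscale_qscale qscale_one)
end

definition rspan :: "'v::rquat_space set \<Rightarrow> 'v set" where
  "rspan S = {\<Sum>x\<in>T. x *\<^sub>H c x |T c. finite T \<and> T \<subseteq> S}"

definition rindep :: "'v::rquat_space set \<Rightarrow> bool" where
  "rindep S \<longleftrightarrow> (\<forall>T c. finite T \<longrightarrow> T \<subseteq> S \<longrightarrow> (\<Sum>x\<in>T. x *\<^sub>H c x) = 0 \<longrightarrow> (\<forall>x\<in>T. c x = 0))"

text \<open>As for the library's \<open>dim\<close>, this is the dimension of the span of \<open>S\<close>; it is 0 by
  convention if that dimension is infinite.\<close>
definition rdim :: "'v::rquat_space set \<Rightarrow> nat" where
  "rdim S = card (SOME B. rindep B \<and> rspan B = rspan S)"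

text \<open>Completeness is not required: every space considered below is spanned by finitely many
  vectors, so it is automatically a Hilbert space.\<close>
class rquat_inner = rquat_space +
  fixes qinner :: "'a \<Rightarrow> 'a \<Rightarrow> quat"
  assumes qinner_add_right: "qinner x (y + z) = qinner x y + qinner x z"
    and qinner_scale_right: "qinner x (y *\<^sub>H a) = qinner x y * a"
    and qinner_cnj: "qinner y x = qcnj (qinner x y)"
    and qinner_nonneg: "qRe (qinner x x) \<ge> 0"
    and qinner_eq_0: "qinner x x = 0 \<Longrightarrow> x = 0"

text \<open>On the finite-dimensional spaces considered below all such operators are bounded.\<close>
typedef (overloaded) ('h::rquat_space) qop =
  "{f :: 'h \<Rightarrow> 'h. (\<forall>x y. f (x + y) = f x + f y) \<and> (\<forall>x a. f (x *\<^sub>H a) = f x *\<^sub>H a)}"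
  morphisms qapply Abs_qop
  by (rule exI[of _ "\<lambda>x. x"]) simp

setup_lifting type_definition_qop

lemma of_real_quat_central: "of_real c * (q :: quat) = q * of_real c"
  by (simp add: of_real_def)

lemma qscale_zero_left [simp]: "0 *\<^sub>H a = (0 :: 'v::rquat_space)"
  using qscale_add_left[of 0 0 a] by simp

lemma qscale_minus_left: "(- x) *\<^sub>H a = - (x *\<^sub>H a)" for x :: "'v::rquat_space"
  using qscale_add_left[of x "- x" a] by (simp add: eq_neg_iff_add_eq_0 add.commute)

instantiation qop :: (rquat_space) "{real_algebra, monoid_mult}"
begin

lift_definition zero_qop :: "'a qop" is "\<lambda>_. 0" by simp
lift_definition one_qop :: "'a qop" is "\<lambda>x. x" by simp
lift_definition plus_qop :: "'a qop \<Rightarrow> 'a qop \<Rightarrow> 'a qop" is "\<lambda>f g x. f x + g x"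
  by (simp add: qscale_add_left algebra_simps)
lift_definition uminus_qop :: "'a qop \<Rightarrow> 'a qop" is "\<lambda>f x. - f x"
  by (simp add: qscale_minus_left)
lift_definition minus_qop :: "'a qop \<Rightarrow> 'a qop \<Rightarrow> 'a qop" is "\<lambda>f g x. f x - g x"
  by (simp only: diff_conv_add_uminus qscale_add_left qscale_minus_left) (simp add: algebra_simps)
lift_definition times_qop :: "'a qop \<Rightarrow> 'a qop \<Rightarrow> 'a qop" is "\<lambda>f g x. f (g x)" by simp
lift_definition scaleR_qop :: "real \<Rightarrow> 'a qop \<Rightarrow> 'a qop" is "\<lambda>c f x. f x *\<^sub>H of_real c"
  by (simp add: qscale_add_left qscale_qscale) (metis of_real_quat_central)

instance
proof
  fix A B C :: "'a qop" and c e :: real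
  show "A + B + C = A + (B + C)" by transfer (simp add: add.assoc)
  show "A + B = B + A" by transfer (simp add: add.commute)
  show "0 + A = A" by transfer simp
  show "- A + A = 0" by transfer simp
  show "A - B = A + - B" by transfer simp
  show "c *\<^sub>R (A + B) = c *\<^sub>R A + c *\<^sub>R B" by transfer (simp add: qscale_add_left)
  show "(c + e) *\<^sub>R A = c *\<^sub>R A + e *\<^sub>R A" by transfer (simp add: qscale_add_right)
  show "c *\<^sub>R e *\<^sub>R A = (c * e) *\<^sub>R A"
    by transfer (simp add: qscale_qscale mult.commute flip: of_real_mult)
  show "1 *\<^sub>R A = A" by transfer (simp add: qscale_one)
  show "A * B * C = A * (B * C)" by transfer simp
  show "(A + B) * C = A * C + B * C" by transfer simp
  show "A * (B + C) = A * B + A * C" by transfer simp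
  show "c *\<^sub>R A * B = c *\<^sub>R (A * B)" by transfer simp
  show "A * c *\<^sub>R B = c *\<^sub>R (A * B)" by transfer simp
  show "1 * A = A" by transfer simp
  show "A * 1 = A" by transfer simp
qed

end

definition qadj :: "'h::rquat_inner qop \<Rightarrow> 'h qop" where
  "qadj A = (THE B. \<forall>x y. qinner (qapply A x) y = qinner x (qapply B y))"

definition ring_commutator :: "'a::ring \<Rightarrow> 'a \<Rightarrow> 'a" where
  "ring_commutator A B = A * B - B * A"

definition sym_part :: "'h::rquat_inner qop set \<Rightarrow> 'h qop set" where
  "sym_part R = {A \<in> R. qadj A = A}"

definition ring_center :: "'a::ring set \<Rightarrow> 'a set" where
  "ring_center R = {A \<in> R. \<forall>B\<in>R. A * B = B * A}"

text \<open>The index set of the variables is a finite type \<open>'n\<close>.\<close>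
datatype 'n letter = Lq (letter_index: 'n) | Lqbar (letter_index: 'n)

type_synonym 'n qword = "'n letter list"

fun letter_star :: "'n letter \<Rightarrow> 'n letter" where
  "letter_star (Lq i) = Lqbar i"
| "letter_star (Lqbar i) = Lq i"

definition word_star :: "'n qword \<Rightarrow> 'n qword" where
  "word_star w = rev (map letter_star w)"

definition qwords :: "nat \<Rightarrow> 'n qword set" where
  "qwords t = {w. length w \<le> t}"

text \<open>A pair \<open>(\<alpha>, u)\<close> stands for \<open>\<Prod>\<^sub>i |q\<^sub>i|\<^bsup>2 \<alpha>\<^sub>i\<^esup> u\<close>.\<close>
inductive nf_step :: "('n \<Rightarrow> nat) \<times> 'n qword \<Rightarrow> ('n \<Rightarrow> nat) \<times> 'n qword \<Rightarrow> bool" where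
  "nf_step (\<alpha>, u @ [a, letter_star a] @ v)
     (\<alpha>(letter_index a := Suc (\<alpha> (letter_index a))), u @ v)"

definition is_normal_form :: "'n qword \<Rightarrow> ('n \<Rightarrow> nat) \<times> 'n qword \<Rightarrow> bool" where
  "is_normal_form w N \<longleftrightarrow> nf_step\<^sup>*\<^sup>* (\<lambda>_. 0, w) N \<and> (\<nexists>N'. nf_step N N')"

definition cyc_equiv :: "'n qword \<Rightarrow> 'n qword \<Rightarrow> bool" where
  "cyc_equiv u v \<longleftrightarrow> (\<exists>w1 w2. u = w1 @ w2 \<and> v = w2 @ w1)"

text \<open>With concatenation as the (additively written) monoid operation on words, the finitely
  supported functions \<open>_ \<Rightarrow>\<^sub>0 real\<close> with the convolution product of
  \<open>Poly_Mapping\<close> are the free algebra.\<close>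
instantiation list :: (type) monoid_add
begin
definition "0 = []"
definition "xs + ys = xs @ ys"
instance by standard (simp_all add: zero_list_def plus_list_def)
end

type_synonym 'n free_alg = "'n qword \<Rightarrow>\<^sub>0 real"

text \<open>The unital algebra homomorphism determined by the images of the letters.\<close>
definition fa_eval :: "('n letter \<Rightarrow> 'b::{real_vector, monoid_mult}) \<Rightarrow> 'n free_alg \<Rightarrow> 'b" where
  "fa_eval X p = (\<Sum>w\<in>Poly_Mapping.keys p. Poly_Mapping.lookup p w *\<^sub>R prod_list (map X w))"

fun letter_val :: "('n \<Rightarrow> quat) \<Rightarrow> 'n letter \<Rightarrow> quat" where
  "letter_val a (Lq i) = a i"
| "letter_val a (Lqbar i) = qcnj (a i)"

definition vanishing_ideal :: "'n free_alg set" where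
  "vanishing_ideal = {p. \<forall>a. fa_eval (letter_val a) p = 0}"

text \<open>Only the values of \<open>y\<close> on \<open>qwords (2 * d)\<close> matter.\<close>
definition pseudo_moments :: "nat \<Rightarrow> ('n qword \<Rightarrow> quat) \<Rightarrow> bool" where
  "pseudo_moments d y \<longleftrightarrow>
     (\<forall>u\<in>qwords (2 * d). \<forall>v\<in>qwords (2 * d). \<forall>N.
        is_normal_form u N \<longrightarrow> is_normal_form v N \<longrightarrow> y u = y v) \<and>
     (\<forall>w\<in>qwords (2 * d). y w = qcnj (y (word_star w))) \<and>
     (\<forall>u\<in>qwords (2 * d). \<forall>v\<in>qwords (2 * d). cyc_equiv u v \<longrightarrow> qRe (y u) = qRe (y v))"

definition moment_matrix :: "('n qword \<Rightarrow> quat) \<Rightarrow> 'n qword \<Rightarrow> 'n qword \<Rightarrow> quat" where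
  "moment_matrix y u v = y (word_star u @ v)"

text \<open>A square matrix with finite index set \<open>I\<close> is a function whose values outside
  \<open>I \<times> I\<close> are irrelevant. For a Hermitian matrix the quadratic form takes real values, so it is enough to look at
  its real part.\<close>
definition qpsd :: "'i set \<Rightarrow> ('i \<Rightarrow> 'i \<Rightarrow> quat) \<Rightarrow> bool" where
  "qpsd I M \<longleftrightarrow> (\<forall>u\<in>I. \<forall>v\<in>I. M u v = qcnj (M v u)) \<and>
     (\<forall>c. qRe (\<Sum>u\<in>I. \<Sum>v\<in>I. qcnj (c u) * M u v * c v) \<ge> 0)"

definition qrank :: "'i set \<Rightarrow> ('i \<Rightarrow> 'i \<Rightarrow> quat) \<Rightarrow> nat" where
  "qrank I M = rdim ((\<lambda>v u. if u \<in> I then M u v else 0) ` I)"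

text \<open>The Hilbert space is the whole type \<open>'h\<close>, with its inner product \<open>qinner\<close>.\<close>
definition canonical_vectors ::
    "nat \<Rightarrow> nat \<Rightarrow> ('n qword \<Rightarrow> quat) \<Rightarrow> ('n qword \<Rightarrow> 'h::rquat_inner) \<Rightarrow> bool" where
  "canonical_vectors d r y v \<longleftrightarrow>
     rspan (v ` qwords d) = UNIV \<and> rdim (UNIV :: 'h set) = r \<and>
     (\<forall>w\<in>qwords d. \<forall>w'\<in>qwords d. qinner (v w) (v w') = y (word_star w @ w'))"

definition shift_op :: "nat \<Rightarrow> ('n qword \<Rightarrow> 'h::rquat_inner) \<Rightarrow> 'n letter \<Rightarrow> 'h qop" where
  "shift_op d v a = (THE X. \<forall>w\<in>qwords (d - 1). qapply X (v w) = v (a # w))"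

definition flat_rep :: "nat \<Rightarrow> ('n qword \<Rightarrow> 'h::rquat_inner) \<Rightarrow> 'n free_alg \<Rightarrow> 'h qop" where
  "flat_rep d v = fa_eval (shift_op d v)"

definition fa_gen :: "'n letter \<Rightarrow> 'n free_alg" where
  "fa_gen a = Poly_Mapping.single [a] 1"

definition real_basis :: "nat \<Rightarrow> (nat \<Rightarrow> 'a::real_vector) \<Rightarrow> 'a set \<Rightarrow> bool" where
  "real_basis s F V \<longleftrightarrow> inj_on F {1..s} \<and> independent (F ` {1..s}) \<and> span (F ` {1..s}) = V"

end

theory Submission
  imports Defs "HOL-Computational_Algebra.Fundamental_Theorem_Algebra"
begin

text \<open>
  If the representation kills \<open>vanishing_ideal\<close>, then symmetric elements are central because
  \<open>p + p\<^sup>*\<close> evaluates to a real scalar at every quaternionic point, so that its commutators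
  with all elements lie in the ideal.

  Conversely, let the symmetric elements of \<open>R\<close> be central and let \<open>T = \<pi>(p)\<close> be nonzero. The
  symmetric elements form a finite-dimensional commutative real algebra in which sums of squares are
  definite, so a minimal ideal of it below \<open>T\<^sup>* T\<close> is one-dimensional and spanned by an idempotent \<open>e\<close>
  with \<open>T e \<noteq> 0\<close>. The algebra \<open>R e\<close> has real symmetric part, hence is a copy of the reals, the
  complex numbers or the quaternions (Frobenius). Therefore \<open>w \<mapsto> \<pi>(w) e\<close> is the
  evaluation at a point of the quaternions, and \<open>p\<close> does not vanish there.
\<close>

section \<open>Real polynomials in an element of a real algebra\<close>

text \<open>The commutators of symmetrized elements are not shown to generate
  \<open>vanishing_ideal\<close>, so the converse cannot argue with generators: for each p with
  nonzero image it must produce a point of the quaternions at which p does not vanish. Positivity of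
  R enters in one form only: \<open>st A * A + st B * B = 0\<close> forces \<open>A = 0\<close>. A
  single square would not suffice, since the complex numbers with trivial star satisfy that weaker
  law. The second square excludes the irreducible quadratics (x - a)^2 + b^2, so that a minimal
  ideal of the symmetric elements cannot be complex, and it forces nonzero skew elements of R e to
  have negative squares, from which the Frobenius argument starts.

  Condition (iii) is (ii) tested on a basis: A \<mapsto> \<open>A + st A\<close> is real-linear and
  doubles symmetric elements. In (iv) the letters q_i suffice, because the commutant of a symmetric
  element is closed under adjoints.\<close>

definition real_poly_eval :: "real poly \<Rightarrow> 'a \<Rightarrow> 'a::{real_algebra, monoid_mult}" where
  "real_poly_eval p z = fold_coeffs (\<lambda>a b. a *\<^sub>R 1 + z * b) p 0"

lemma real_poly_eval_0 [simp]: "real_poly_eval 0 z = 0"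
  by (simp add: real_poly_eval_def)

lemma real_poly_eval_pCons [simp]: 
  "real_poly_eval (pCons a p) z = a *\<^sub>R 1 + z * real_poly_eval p z"
  by (cases "p = 0 \<and> a = 0")
     (auto simp: real_poly_eval_def fold_coeffs_pCons_not_0_0_eq fold_coeffs_pCons_coeff_not_0_eq)

lemma real_poly_eval_add: "real_poly_eval (p + q) z = real_poly_eval p z + real_poly_eval q z"
proof (induction p q rule: poly_induct2)
  case (pCons a p b q)
  then show ?case by (simp add: scaleR_add_left distrib_left)
qed simp

lemma real_poly_eval_smult: "real_poly_eval (smult c p) z = c *\<^sub>R real_poly_eval p z"
  by (induction p) (simp_all add: scaleR_add_right)

lemma real_poly_eval_mult: "real_poly_eval (p * q) z = real_poly_eval p z * real_poly_eval q z"
  by (induction p)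
     (simp_all add: real_poly_eval_add real_poly_eval_smult distrib_right mult.assoc)

lemma real_poly_eval_monom: "real_poly_eval (monom c k) z = c *\<^sub>R z ^ k"
  by (induction k) (simp_all add: monom_0 monom_Suc)

lemma real_poly_eval_sum: "real_poly_eval (\<Sum>i\<in>I. f i) z = (\<Sum>i\<in>I. real_poly_eval (f i) z)"
  by (induction I rule: infinite_finite_induct) (simp_all add: real_poly_eval_add)

lemma real_poly_eval_complex: "real_poly_eval p z = poly (map_poly complex_of_real p) z"
  by (induction p) (simp_all add: map_poly_pCons scaleR_conv_of_real)

text \<open>A complex root a + bi of p yields the factor: x - a if b = 0, otherwise (x - a)^2 + b^2,
  because a real remainder of degree at most 1 with a nonreal root is zero. The coefficients stay
  explicit so that the quadratic can later be read as a sum of two squares.\<close>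

lemma real_poly_factor_cases:
  fixes p :: "real poly"
  assumes "degree p > 0"
  obtains (linear) a q where "p = [:-a, 1:] * q"
  | (quadratic) a b q where "b \<noteq> 0" "p = [:a\<^sup>2 + b\<^sup>2, - 2 * a, 1:] * q"
proof -
  have "\<not> constant (poly (map_poly complex_of_real p))"
    using assms by (simp add: constant_degree degree_map_poly)
  then obtain c where "poly (map_poly complex_of_real p) c = 0"
    using fundamental_theorem_of_algebra by blast
  then have root: "real_poly_eval p c = 0"
    by (simp add: real_poly_eval_complex)
  define a b where "a = Re c" and "b = Im c"
  have c: "c = Complex a b"
    by (simp add: a_def b_def)
  show thesis
  proof (cases "b = 0")
    case True
    then have "c = of_real a"
      by (simp add: c complex_eq_iff)
    moreover have "real_poly_eval p (complex_of_real a) = of_real (poly p a)"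
      by (induction p) (simp_all add: scaleR_conv_of_real)
    ultimately have "poly p a = 0"
      using root by simp
    then show thesis
      using linear by (auto simp: poly_eq_0_iff_dvd dvd_def)
  next
    case False
    define m where "m = [:a\<^sup>2 + b\<^sup>2, - 2 * a, 1:]"
    have mc: "real_poly_eval m c = 0"
      by (simp add: m_def c complex_eq_iff power2_eq_square algebra_simps)
    have p: "p = m * (p div m) + p mod m"
      by simp
    have rc: "real_poly_eval (p mod m) c = 0"
      using root mc by (subst (asm) p) (simp only: real_poly_eval_add real_poly_eval_mult mult_zero_left add_0)
    have "degree m = 2"
      by (simp add: m_def)
    then have "degree (p mod m) < 2"
      using degree_mod_less[of m p] by fastforce
    then have r: "p mod m = [:coeff (p mod m) 0, coeff (p mod m) 1:]"
      by (intro poly_eqI) (auto simp: coeff_pCons coeff_eq_0 split: nat.split)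
    define r0 r1 where "r0 = coeff (p mod m) 0" and "r1 = coeff (p mod m) 1"
    have r: "p mod m = [:r0, r1:]"
      using r unfolding r0_def r1_def .
    have "r0 + r1 * a = 0" "r1 * b = 0"
      using rc by (simp_all add: r c complex_eq_iff algebra_simps)
    then have "p mod m = 0"
      using False by (simp add: r)
    then show thesis
      using quadratic[OF False] p by (simp add: m_def)
  qed
qed

section \<open>Dimension counts inside finitely spanned real spaces\<close>

lemma finite_span_basis:
  fixes V :: "'a::real_vector set"
  assumes "finite B" "V \<subseteq> span B"
  obtains C where "finite C" "C \<subseteq> V" "independent C" "V \<subseteq> span C" "card C = dim V"
proof -
  obtain C where C: "C \<subseteq> V" "independent C" "V \<subseteq> span C" "card C = dim V"
    using basis_exists by blast
  with that show thesis
    using independent_span_bound[OF assms(1) C(2)] assms(2) by blast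
qed

lemma dim_psubset_less:
  fixes V W :: "'a::real_vector set"
  assumes "finite B" "W \<subseteq> span B" "subspace V" "V \<subset> W"
  shows "dim V < dim W"
proof -
  obtain C where C: "finite C" "C \<subseteq> V" "independent C" "V \<subseteq> span C" "card C = dim V"
    using finite_span_basis[OF assms(1), of V] assms(2,4) by (metis order_trans psubset_imp_subset)
  obtain x where x: "x \<in> W" "x \<notin> V"
    using assms by blast
  have "x \<notin> span C"
    using C(2) assms(3) x(2) span_minimal by blast
  then have ind: "independent (insert x C)"
    using C by (simp add: independent_insert)
  obtain D where D: "finite D" "W \<subseteq> span D" "card D = dim W"
    using finite_span_basis[OF assms(1,2)] by metis
  have "card (insert x C) \<le> card D"
    using independent_span_bound[OF D(1) ind] C(2) D(2) x assms(4) by blast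
  moreover have "x \<notin> C"
    using x C by blast
  ultimately show ?thesis
    using C D by simp
qed

text \<open>More powers of z than spanning vectors are linearly dependent. Dependence is a property
  of sets, so a repetition among the powers is treated separately; it gives x^i - x^j.\<close>

lemma annihilating_poly_exists:
  fixes z :: "'a::{real_algebra, monoid_mult}"
  assumes "finite B" "\<And>k. z ^ k \<in> span B"
  obtains p where "p \<noteq> 0" "real_poly_eval p z = 0"
proof (cases "inj (\<lambda>k. z ^ k)")
  case False
  then obtain i j where ij: "z ^ i = z ^ j" "i \<noteq> j"
    by (auto simp: inj_def)
  let ?p = "monom (1::real) i + monom (-1) j"
  have "coeff ?p i = 1"
    using ij by (simp add: coeff_monom)
  then have "?p \<noteq> 0"
    by (metis coeff_0 zero_neq_one)
  then show thesis
    using that[of ?p] ij by (simp add: real_poly_eval_add real_poly_eval_monom)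
next
  case True
  let ?S = "(\<lambda>k. z ^ k) ` {..card B}"
  have inj: "inj_on (\<lambda>k. z ^ k) {..card B}"
    using True by (rule inj_on_subset) simp
  have "card ?S = Suc (card B)"
    using inj by (simp add: card_image)
  then have "dependent ?S"
    using independent_span_bound[OF assms(1), of ?S] assms(2) by fastforce
  then obtain u where u: "\<exists>x\<in>?S. u x \<noteq> 0" "(\<Sum>x\<in>?S. u x *\<^sub>R x) = 0"
    by (auto simp: dependent_finite)
  let ?p = "\<Sum>k\<le>card B. monom (u (z ^ k)) k"
  obtain k where k: "k \<le> card B" "u (z ^ k) \<noteq> 0"
    using u(1) by auto
  have "coeff ?p k = u (z ^ k)"
    using k(1) by (simp add: coeff_sum coeff_monom sum.delta')
  then have "?p \<noteq> 0"
    using k by auto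
  moreover have "real_poly_eval ?p z = (\<Sum>x\<in>?S. u x *\<^sub>R x)"
    using inj by (simp add: real_poly_eval_sum real_poly_eval_monom sum.reindex)
  ultimately show thesis
    using that u(2) by metis
qed

section \<open>Real star-algebras with central symmetric elements\<close>

lemma qcnj_sel [simp]:
  "qRe (qcnj q) = qRe q" "qI (qcnj q) = - qI q" "qJ (qcnj q) = - qJ q" "qK (qcnj q) = - qK q"
  by (simp_all add: qcnj_def)

text \<open>The right-hand side is the quaternion product in coordinates. The unit is an idempotent
  e instead of 1, which is why its absorption laws are listed among the relations.\<close>

lemma quaternion_relations_mult:
  fixes e I J K :: "'a::real_algebra"
  assumes "e * e = e" "e * I = I" "I * e = I" "e * J = J" "J * e = J" "e * K = K" "K * e = K"
    "I * I = - e" "J * J = - e" "K * K = - e" "I * J = K" "J * I = - K"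
    "I * K = - J" "K * I = J" "J * K = I" "K * J = - I"
  shows "(a *\<^sub>R e + b *\<^sub>R I + c *\<^sub>R J + d *\<^sub>R K) * (a' *\<^sub>R e + b' *\<^sub>R I + c' *\<^sub>R J + d' *\<^sub>R K) =
    (a * a' - b * b' - c * c' - d * d') *\<^sub>R e + (a * b' + b * a' + c * d' - d * c') *\<^sub>R I +
    (a * c' - b * d' + c * a' + d * b') *\<^sub>R J + (a * d' + b * c' - c * b' + d * a') *\<^sub>R K"
  by (simp only: distrib_left distrib_right mult_scaleR_left mult_scaleR_right scaleR_scaleR assms
       scaleR_minus_right scaleR_minus_left scaleR_add_right scaleR_add_left scaleR_diff_left diff_conv_add_uminus add_ac mult.commute)

text \<open>R is a carrier inside a type that may be infinite-dimensional, hence the finite set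
  \<open>Bs\<close> that bounds it. The sort leaves 1 = 0 possible, as happens for operators on the
  zero space.\<close>

locale positive_star_algebra =
  fixes R :: "'a::{real_algebra, monoid_mult} set" and st :: "'a \<Rightarrow> 'a" and Bs :: "'a set"
  assumes fin: "finite Bs" "R \<subseteq> span Bs"
    and subspace: "subspace R"
    and one_mem: "1 \<in> R"
    and mult_mem: "\<And>A B. A \<in> R \<Longrightarrow> B \<in> R \<Longrightarrow> A * B \<in> R"
    and st_mem: "\<And>A. A \<in> R \<Longrightarrow> st A \<in> R"
    and st_add: "\<And>A B. A \<in> R \<Longrightarrow> B \<in> R \<Longrightarrow> st (A + B) = st A + st B"
    and st_scaleR: "\<And>A c. A \<in> R \<Longrightarrow> st (c *\<^sub>R A) = c *\<^sub>R st A"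
    and st_st: "\<And>A. A \<in> R \<Longrightarrow> st (st A) = A"
    and st_mult: "\<And>A B. A \<in> R \<Longrightarrow> B \<in> R \<Longrightarrow> st (A * B) = st B * st A"
    and definite: "\<And>A B. A \<in> R \<Longrightarrow> B \<in> R \<Longrightarrow> st A * A + st B * B = 0 \<Longrightarrow> A = 0"
begin

lemma add_mem: "A \<in> R \<Longrightarrow> B \<in> R \<Longrightarrow> A + B \<in> R"
  and scaleR_mem: "A \<in> R \<Longrightarrow> c *\<^sub>R A \<in> R"
  and diff_mem: "A \<in> R \<Longrightarrow> B \<in> R \<Longrightarrow> A - B \<in> R"
  and zero_mem: "0 \<in> R"
  using subspace by (auto intro: subspace_add subspace_scale subspace_diff subspace_0)

lemma uminus_mem: "A \<in> R \<Longrightarrow> - A \<in> R"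
  using diff_mem[OF zero_mem] by simp

lemma st_zero: "st 0 = 0"
  using st_scaleR[OF zero_mem, of 0] by simp

lemma st_uminus: "A \<in> R \<Longrightarrow> st (- A) = - st A"
  using st_scaleR[of A "-1"] by simp

lemma st_diff: "A \<in> R \<Longrightarrow> B \<in> R \<Longrightarrow> st (A - B) = st A - st B"
  using st_add[of A "- B"] by (simp add: st_uminus uminus_mem)

lemma st_one: "st 1 = 1"
  using st_mult[OF st_mem[OF one_mem] one_mem] st_st[OF one_mem] by simp

lemma st_mult_self_eq_0: "A \<in> R \<Longrightarrow> st A * A = 0 \<Longrightarrow> A = 0"
  using definite[OF _ zero_mem, of A] by simp

definition Sym :: "'a set" where "Sym = {A \<in> R. st A = A}"

lemma subspace_Sym: "subspace Sym"
  unfolding Sym_def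
  by (rule subspaceI) (simp_all add: zero_mem st_zero add_mem st_add scaleR_mem st_scaleR)

lemma one_Sym: "1 \<in> Sym"
  by (simp add: Sym_def one_mem st_one)

end

locale central_star_algebra = positive_star_algebra +
  assumes central: "\<And>A B. A \<in> R \<Longrightarrow> st A = A \<Longrightarrow> B \<in> R \<Longrightarrow> A * B = B * A"
begin

section \<open>Ideals of the commutative algebra of symmetric elements\<close>

lemma Sym_commute: "A \<in> Sym \<Longrightarrow> B \<in> R \<Longrightarrow> A * B = B * A"
  using central[of A B] by (auto simp: Sym_def)

lemma mult_Sym: "A \<in> Sym \<Longrightarrow> B \<in> Sym \<Longrightarrow> A * B \<in> Sym"
  using Sym_commute[of A B] by (simp add: Sym_def mult_mem st_mult)

lemma real_poly_eval_Sym: "z \<in> Sym \<Longrightarrow> real_poly_eval p z \<in> Sym"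
  by (induction p)
     (auto intro!: subspace_add[OF subspace_Sym] subspace_scale[OF subspace_Sym] one_Sym mult_Sym
        subspace_0[OF subspace_Sym])

lemma power_Sym: "z \<in> Sym \<Longrightarrow> z ^ k \<in> Sym"
  by (induction k) (auto intro: one_Sym mult_Sym)

abbreviation principal :: "'a \<Rightarrow> 'a set" where "principal w \<equiv> (*) w ` Sym"

lemma subspace_principal: "subspace (principal w)"
proof -
  have "linear ((*) w)"
    by (rule linearI) (simp_all add: distrib_left)
  then show ?thesis
    using linear_subspace_image subspace_Sym by blast
qed

lemma principal_subset_Sym: "w \<in> Sym \<Longrightarrow> principal w \<subseteq> Sym"
  by (auto intro: mult_Sym)

lemma principal_mono: "f \<in> principal w \<Longrightarrow> principal f \<subseteq> principal w"
  by (auto simp: mult.assoc intro: mult_Sym)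

lemma self_principal: "w \<in> principal w"
  using one_Sym by (rule rev_image_eqI) simp

text \<open>The generator of a minimal ideal of the commutative algebra \<open>Sym\<close> below \<open>S\<close>. Since a minimal
  ideal is a field in which sums of squares are definite, it is one-dimensional.\<close>
lemma minimal_idempotent_exists:
  assumes S: "S \<in> Sym" "S \<noteq> 0"
  obtains e where "e \<in> Sym" "e \<noteq> 0" "e * e = e" "S * e \<noteq> 0"
    "\<forall>z\<in>Sym. \<exists>c. z * e = c *\<^sub>R e"
proof -
  have "\<exists>w. w \<in> principal S \<and> w \<noteq> 0"
    using self_principal S by blast
  \<comment> \<open>Least dimension among the nonzero principal ideals below S yields minimality
    under inclusion, since a proper subspace has smaller dimension.\<close>
  then obtain w where w: "w \<in> principal S" "w \<noteq> 0"
    and least: "\<And>f. f \<in> principal S \<Longrightarrow> f \<noteq> 0 \<Longrightarrow> dim (principal w) \<le> dim (principal f)"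
    using ex_has_least_nat[of "\<lambda>w. w \<in> principal S \<and> w \<noteq> 0" _ "\<lambda>w. dim (principal w)"] by metis
  have wSym: "w \<in> Sym"
    using w principal_subset_Sym S by blast
  have minimal: "principal f = principal w" if "f \<in> principal w" "f \<noteq> 0" for f
  proof (rule ccontr)
    assume ne: "principal f \<noteq> principal w"
    have sub: "principal f \<subseteq> principal w"
      by (rule principal_mono[OF that(1)])
    have "principal w \<subseteq> span Bs"
      using principal_subset_Sym[OF wSym] fin by (auto simp: Sym_def)
    then have "dim (principal f) < dim (principal w)"
      using dim_psubset_less[OF fin(1) _ subspace_principal] sub ne by blast
    moreover have "f \<in> principal S"
      using that principal_mono[OF w(1)] by blast
    ultimately show False
      using least[of f] that by simp
  qed
  \<comment> \<open>Definiteness keeps the square of the symmetric w nonzero, so by minimality w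
    lies in the ideal of its square: w = w w z. Then w z acts as the unit of the ideal.\<close>
  have "w * w \<noteq> 0"
    using st_mult_self_eq_0[of w] wSym w(2) by (auto simp: Sym_def)
  moreover have "w * w \<in> principal w"
    using wSym by blast
  ultimately have "w \<in> principal (w * w)"
    using minimal self_principal by blast
  then obtain z where z: "z \<in> Sym" "w = w * w * z"
    by blast
  define e where "e = w * z"
  have we: "w * e = w"
    using z by (simp add: e_def mult.assoc)
  have eSym: "e \<in> Sym"
    using z wSym by (simp add: e_def mult_Sym)
  have e0: "e \<noteq> 0"
    using we w by auto
  have comm: "a * b = b * a" if "a \<in> Sym" "b \<in> Sym" for a b
    using that Sym_commute by (simp add: Sym_def)
  have ee: "e * e = e"
  proof -
    have "e * e = (w * e) * z"
      using comm[OF z(1) eSym] by (simp add: e_def mult.assoc)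
    then show ?thesis
      by (simp only: we flip: e_def)
  qed
  have e_principal: "e \<in> principal w"
    using z by (simp add: e_def)
  obtain t where t: "t \<in> Sym" "e = S * t"
    using principal_mono[OF w(1)] e_principal by blast
  \<comment> \<open>Since e = S t, the equation S e = 0 would give e = e e = S e t = 0.\<close>
  have "S * e \<noteq> 0"
  proof
    assume "S * e = 0"
    then have "e * e = 0"
      using comm[OF t(1) eSym] by (metis t(2) mult.assoc mult_zero_left)
    then show False
      using e0 ee by simp
  qed
  moreover have "\<exists>c. z * e = c *\<^sub>R e" if z: "z \<in> Sym" for z
  proof -
    \<comment> \<open>\<open>N p\<close> says that p annihilates z on the ideal with unit e; an
      element of least degree serves as the minimal polynomial of z there.\<close>
    define N where "N p \<longleftrightarrow> p \<noteq> 0 \<and> real_poly_eval p z * e = 0" for p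
    have "z ^ k \<in> span Bs" for k
      using power_Sym[OF z, of k] fin(2) by (auto simp: Sym_def)
    then obtain p0 where "p0 \<noteq> 0" "real_poly_eval p0 z = 0"
      using annihilating_poly_exists[OF fin(1), of z] by metis
    then have "N p0"
      by (simp add: N_def)
    then obtain p where p: "N p" and pmin: "\<And>q. N q \<Longrightarrow> degree p \<le> degree q"
      using ex_has_least_nat[of N _ degree] by metis
    have "degree p > 0"
    proof (rule ccontr)
      assume "\<not> degree p > 0"
      then obtain a where "p = [:a:]"
        by (auto elim: degree_eq_zeroE)
      then show False
        using p e0 by (simp add: N_def)
    qed
    \<comment> \<open>The cofactor q has smaller degree than p, so q(z) e is nonzero and by
      minimality generates the ideal: e = q(z) e t. Hence m(z) e = p(z) e t = 0.\<close>
    have factor: "real_poly_eval m z * e = 0" if "p = m * q" "degree m > 0" for m q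
    proof -
      have q0: "q \<noteq> 0" "m \<noteq> 0"
        using p that by (auto simp: N_def)
      then have "degree q < degree p"
        using that by (simp add: degree_mult_eq)
      then have ne: "real_poly_eval q z * e \<noteq> 0"
        using pmin[of q] q0 by (auto simp: N_def)
      have "real_poly_eval q z * e = e * real_poly_eval q z"
        using comm[OF real_poly_eval_Sym[OF z] eSym] .
      also have "\<dots> \<in> principal e"
        using real_poly_eval_Sym[OF z] by blast
      finally have "real_poly_eval q z * e \<in> principal w"
        using principal_mono[OF e_principal] by blast
      then have "e \<in> principal (real_poly_eval q z * e)"
        using minimal ne e_principal by blast
      then obtain t where "e = real_poly_eval q z * e * t"
        by blast
      then have "real_poly_eval m z * e = real_poly_eval p z * e * t"
        by (metis mult.assoc real_poly_eval_mult that(1))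
      then show ?thesis
        using p by (simp add: N_def)
    qed
    show ?thesis
    proof (cases rule: real_poly_factor_cases[OF \<open>degree p > 0\<close>])
      case (1 a q)
      then have "real_poly_eval [:- a, 1:] z * e = 0"
        by (intro factor) auto
      then have "z * e = a *\<^sub>R e"
        by (simp add: left_diff_distrib)
      then show ?thesis
        by blast
    next
      case (2 a b q)
      then have *: "real_poly_eval [:a\<^sup>2 + b\<^sup>2, - 2 * a, 1:] z * e = 0"
        by (intro factor) auto
      \<comment> \<open>The quadratic is (z - a)^2 + b^2; multiplied by e it becomes the sum of the
        squares of the symmetric elements f and b e, and definiteness contradicts b \<noteq>
        0.\<close>
      define f where "f = (z - a *\<^sub>R 1) * e"
      have zaSym: "z - a *\<^sub>R 1 \<in> Sym"
        using z by (intro subspace_diff subspace_scale subspace_Sym one_Sym)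
      have fSym: "f \<in> Sym"
        unfolding f_def using zaSym eSym by (rule mult_Sym)
      have beSym: "b *\<^sub>R e \<in> Sym"
        using eSym by (intro subspace_scale subspace_Sym)
      have "f * f = (z - a *\<^sub>R 1) * (e * (z - a *\<^sub>R 1)) * e"
        by (simp add: f_def mult.assoc)
      also have "\<dots> = (z - a *\<^sub>R 1) * (z - a *\<^sub>R 1) * e"
        by (subst comm[OF eSym zaSym]) (simp add: mult.assoc ee)
      finally have ff: "f * f = (z - a *\<^sub>R 1) * (z - a *\<^sub>R 1) * e" .
      have double: "(2 * a) *\<^sub>R x = a *\<^sub>R x + a *\<^sub>R x" for x :: 'a
        by (metis mult_2 scaleR_add_left)
      have "(b *\<^sub>R e) * (b *\<^sub>R e) + f * f = real_poly_eval [:a\<^sup>2 + b\<^sup>2, - 2 * a, 1:] z * e"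
        by (simp add: ff ee double power2_eq_square scaleR_add_left scaleR_diff_right left_diff_distrib
            right_diff_distrib distrib_left distrib_right mult.assoc)
      then have "(b *\<^sub>R e) * (b *\<^sub>R e) + f * f = 0"
        by (simp only: *)
      then have "b *\<^sub>R e = 0"
        using definite[of "b *\<^sub>R e" f] fSym beSym by (simp add: Sym_def)
      then show ?thesis
        using 2 e0 by simp
    qed
  qed
  ultimately show thesis
    using that[OF eSym e0 ee] by blast
qed

text \<open>R e is the real line through e plus the skew elements \<open>U\<close>, so only
  \<open>U\<close> has to be understood. There the anticommutator is a real multiple of e and serves
  as a definite bilinear form, with anticommuting as orthogonality. \<open>Q\<close> is the copy of
  the reals, the complex numbers or the quaternions inside \<open>quat\<close>; \<psi> is linear on
  all of \<open>quat\<close>, but multiplicativity is claimed on \<open>Q\<close> alone.\<close>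

lemma frobenius:
  assumes e: "e \<in> Sym" "e \<noteq> 0" "e * e = e"
    and scalar: "\<forall>z\<in>Sym. \<exists>c. z * e = c *\<^sub>R e"
  obtains \<psi> :: "quat \<Rightarrow> 'a" and Q where
    "linear \<psi>" "\<psi> 1 = e" "1 \<in> Q"
    "\<forall>p\<in>Q. \<forall>q\<in>Q. p * q \<in> Q \<and> \<psi> (p * q) = \<psi> p * \<psi> q"
    "\<forall>q\<in>Q. qcnj q \<in> Q \<and> \<psi> (qcnj q) = st (\<psi> q)"
    "\<forall>A\<in>R. \<exists>q\<in>Q. A * e = \<psi> q"
proof -
  have eR: "e \<in> R" and ste: "st e = e"
    using e by (auto simp: Sym_def)
  have eA: "e * A = A * e" if "A \<in> R" for A
    using Sym_commute e(1) that by blast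
  define U where "U = {L \<in> R. L * e = L \<and> st L = - L}"
  have UR: "L \<in> R" and Ue: "L * e = L" "e * L = L" and Ust: "st L = - L" if "L \<in> U" for L
    using that eA by (auto simp: U_def)
  have U_add: "L + M \<in> U" if "L \<in> U" "M \<in> U" for L M
    using that by (auto simp: U_def add_mem st_add distrib_right)
  have U_scale: "c *\<^sub>R L \<in> U" if "L \<in> U" for L c
    using that by (auto simp: U_def scaleR_mem st_scaleR)
  have decomp: "\<exists>t u. u \<in> U \<and> A * e = t *\<^sub>R e + u" if A: "A \<in> R" for A
  proof -
    define s where "s = (1/2) *\<^sub>R (A + st A)"
    define u where "u = ((1/2) *\<^sub>R (A - st A)) * e"
    have "s \<in> Sym"
      using A by (simp add: s_def Sym_def st_scaleR st_add add_mem scaleR_mem st_mem st_st add.commute)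
    then obtain t where "s * e = t *\<^sub>R e"
      using scalar by blast
    moreover have "A = s + (1/2) *\<^sub>R (A - st A)"
      unfolding s_def scaleR_add_right[symmetric] by (simp add: scaleR_half_double)
    ultimately have "A * e = t *\<^sub>R e + u"
      unfolding u_def by (metis distrib_right)
    moreover have "u \<in> U"
    proof -
      let ?D = "(1/2) *\<^sub>R (A - st A)"
      have D: "?D \<in> R" "st ?D = - ?D"
        using A by (simp_all add: scaleR_mem diff_mem st_mem st_scaleR st_diff st_st scaleR_diff_right)
      then have "st u = - u"
        unfolding u_def using eA[OF D(1)] by (simp only: st_mult[OF D(1) eR] ste) simp
      moreover have "u \<in> R"
        unfolding u_def by (rule mult_mem[OF D(1) eR])
      moreover have "u * e = u"
        by (simp add: u_def mult.assoc e)
      ultimately show ?thesis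
        by (simp add: U_def)
    qed
    ultimately show ?thesis
      by blast
  qed
  \<comment> \<open>The star reverses each product and the two signs cancel, so the anticommutator
    of skew elements is symmetric and \<open>scalar\<close> applies.\<close>
  have anti: "\<exists>c. L * M + M * L = c *\<^sub>R e" if "L \<in> U" "M \<in> U" for L M
  proof -
    have "L * M + M * L \<in> Sym"
      using UR[OF that(1)] UR[OF that(2)] Ust[OF that(1)] Ust[OF that(2)]
      by (simp add: Sym_def add_mem mult_mem st_add st_mult add.commute)
    then obtain c where "(L * M + M * L) * e = c *\<^sub>R e"
      using scalar by blast
    then show ?thesis
      using Ue[OF that(1)] Ue[OF that(2)] by (metis distrib_right mult.assoc)
  qed
  have unit: "\<exists>I k. I \<in> U \<and> I * I = - e \<and> L = k *\<^sub>R I" if L: "L \<in> U" "L \<noteq> 0" for L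
  proof -
    obtain c where "L * L + L * L = c *\<^sub>R e"
      using anti[OF L(1) L(1)] by blast
    then have LL: "L * L = (c / 2) *\<^sub>R e"
      by (metis (no_types, lifting) scaleR_2 scaleR_half_double scaleR_scaleR times_divide_eq_left
          mult_1 mult.commute scaleR_add_right)
    \<comment> \<open>For c \<ge> 0 the square of L is that of sqrt(c/2) e. Since L is skew,
      \<open>st L * L\<close> cancels against it, and definiteness gives L = 0.\<close>
    have "c < 0"
    proof (rule ccontr)
      assume "\<not> c < 0"
      then have "st L * L + st (sqrt (c / 2) *\<^sub>R e) * (sqrt (c / 2) *\<^sub>R e) = 0"
        using L by (simp add: Ust st_scaleR eR ste e LL)
      then show False
        using definite[OF UR[OF L(1)] scaleR_mem[OF eR]] L(2) by blast
    qed
    define k where "k = sqrt (- c / 2)"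
    have k: "k \<noteq> 0" "k * k = - c / 2"
      using \<open>c < 0\<close> by (auto simp: k_def)
    define I where "I = (1 / k) *\<^sub>R L"
    have "I * I = ((c / 2) / (k * k)) *\<^sub>R e"
      by (simp add: I_def LL)
    also have "\<dots> = - e"
      using \<open>c < 0\<close> by (simp add: k)
    finally have "I * I = - e" .
    moreover have "I \<in> U"
      unfolding I_def using L U_scale by blast
    moreover have "L = k *\<^sub>R I"
      using k by (simp add: I_def)
    ultimately show ?thesis
      by blast
  qed
  \<comment> \<open>One formula for all three cases: a missing unit is replaced by 0, and
    \<open>Q\<close> then consists of the quaternions whose coordinate there is 0.\<close>
  define \<psi> where "\<psi> I J K q = qRe q *\<^sub>R e + qI q *\<^sub>R I + qJ q *\<^sub>R J + qK q *\<^sub>R K" for I J K q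
  have lin: "linear (\<psi> I J K)" for I J K
    by (rule linearI) (simp_all add: \<psi>_def scaleR_add_left scaleR_add_right)
  have psi1: "\<psi> I J K 1 = e" for I J K
    by (simp add: \<psi>_def)
  have psi_cnj: "\<psi> I J K (qcnj q) = st (\<psi> I J K q)" if "I \<in> U" "J \<in> U" "K \<in> U" for I J K q
    using that by (simp add: \<psi>_def qcnj_def UR Ust st_add st_scaleR scaleR_mem add_mem eR ste)
  have U0: "0 \<in> U"
    by (simp add: U_def zero_mem st_zero)
  \<comment> \<open>\<open>U\<close> is zero, a line, or contains two independent elements. The last
    case forces a full quaternion triple.\<close>
  consider "U \<subseteq> {0}" | I where "I \<in> U" "I * I = - e" "\<And>L. L \<in> U \<Longrightarrow> \<exists>k. L = k *\<^sub>R I"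
    | I L where "I \<in> U" "I * I = - e" "L \<in> U" "\<nexists>k. L = k *\<^sub>R I"
    using unit by (metis insertCI subsetI)
  then show thesis
  proof cases
    case 1
    show thesis
    proof (rule that[of "\<psi> 0 0 0" "{q. qI q = 0 \<and> qJ q = 0 \<and> qK q = 0}"])
      have "\<exists>q\<in>{q. qI q = 0 \<and> qJ q = 0 \<and> qK q = 0}. A * e = \<psi> 0 0 0 q" if A: "A \<in> R" for A
      proof -
        obtain t u where "u \<in> U" "A * e = t *\<^sub>R e + u"
          using decomp[OF A] by blast
        then show ?thesis
          using 1 by (intro bexI[of _ "Quat t 0 0 0"]) (auto simp: \<psi>_def)
      qed
      then show "\<forall>A\<in>R. \<exists>q\<in>{q. qI q = 0 \<and> qJ q = 0 \<and> qK q = 0}. A * e = \<psi> 0 0 0 q"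
        by blast
      show "\<forall>p\<in>{q. qI q = 0 \<and> qJ q = 0 \<and> qK q = 0}. \<forall>q\<in>{q. qI q = 0 \<and> qJ q = 0 \<and> qK q = 0}.
          p * q \<in> {q. qI q = 0 \<and> qJ q = 0 \<and> qK q = 0} \<and> \<psi> 0 0 0 (p * q) = \<psi> 0 0 0 p * \<psi> 0 0 0 q"
        by (auto simp: \<psi>_def e)
    qed (use psi_cnj[OF U0 U0 U0] in \<open>simp_all add: lin psi1\<close>)
  next
    case (2 I)
    show thesis
    proof (rule that[of "\<psi> I 0 0" "{q. qJ q = 0 \<and> qK q = 0}"])
      have "\<exists>q\<in>{q. qJ q = 0 \<and> qK q = 0}. A * e = \<psi> I 0 0 q" if A: "A \<in> R" for A
      proof -
        obtain t u where tu: "u \<in> U" "A * e = t *\<^sub>R e + u"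
          using decomp[OF A] by blast
        then obtain k where "u = k *\<^sub>R I"
          using 2 by blast
        then show ?thesis
          using tu by (intro bexI[of _ "Quat t k 0 0"]) (auto simp: \<psi>_def)
      qed
      then show "\<forall>A\<in>R. \<exists>q\<in>{q. qJ q = 0 \<and> qK q = 0}. A * e = \<psi> I 0 0 q"
        by blast
      show "\<forall>p\<in>{q. qJ q = 0 \<and> qK q = 0}. \<forall>q\<in>{q. qJ q = 0 \<and> qK q = 0}.
          p * q \<in> {q. qJ q = 0 \<and> qK q = 0} \<and> \<psi> I 0 0 (p * q) = \<psi> I 0 0 p * \<psi> I 0 0 q"
        using Ue[OF 2(1)] by (auto simp: \<psi>_def e 2(2) algebra_simps)
    qed (use psi_cnj[OF 2(1) U0 U0] in \<open>simp_all add: lin psi1\<close>)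
  next
    case (3 I L)
    have half: "a - (c / 2) *\<^sub>R e + (b - (c / 2) *\<^sub>R e) = a + b - c *\<^sub>R e" for a b c
    proof -
      have "c *\<^sub>R e = (c / 2) *\<^sub>R e + (c / 2) *\<^sub>R e"
        by (simp flip: scaleR_add_left)
      then show ?thesis
        by (simp only:) (simp add: algebra_simps)
    qed
    obtain c where c: "I * L + L * I = c *\<^sub>R e"
      using anti 3 by blast
    \<comment> \<open>Gram-Schmidt for the anticommutator: as I I = - e, adding (c/2) I to L cancels
      c e, so that J0 anticommutes with I.\<close>
    define J0 where "J0 = L + (c / 2) *\<^sub>R I"
    have J0: "J0 \<in> U" "J0 \<noteq> 0"
    proof -
      show "J0 \<in> U"
        unfolding J0_def by (intro U_add U_scale 3)
      show "J0 \<noteq> 0"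
      proof
        assume "J0 = 0"
        then have "L = (- c / 2) *\<^sub>R I"
          by (simp add: J0_def add_eq_0_iff2)
        then show False
          using 3(4) by blast
      qed
    qed
    then obtain J k where J: "J \<in> U" "J * J = - e" "J0 = k *\<^sub>R J"
      using unit by blast
    have "I * J0 + J0 * I = 0"
      using c by (simp add: J0_def distrib_left distrib_right 3(2) half)
    then have "k *\<^sub>R (I * J + J * I) = 0"
      by (simp add: J(3) scaleR_add_right)
    then have JI: "J * I = - (I * J)"
      using J0 J(3) by (auto simp: add_eq_0_iff)
    define K where "K = I * J"
    have KU: "K \<in> U"
      unfolding U_def K_def using 3(1) J(1)
      by (auto simp: UR mult_mem mult.assoc Ue st_mult Ust JI)
    have red: "I * (I * A) = - (e * A)" "J * (J * A) = - (e * A)" "J * (I * A) = - (I * (J * A))" for A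
      using 3(2) J(2) JI by (metis mult.assoc mult_minus_left)+
    have IJ_rules: "I * I = - e" "J * J = - e" "K * K = - e" "I * J = K" "J * I = - K"
      "I * K = - J" "K * I = J" "J * K = I" "K * J = - I"
      using 3(1,2) J(1,2) by (simp_all add: K_def mult.assoc red JI Ue)
    have span: "\<exists>x y z. L = x *\<^sub>R I + y *\<^sub>R J + z *\<^sub>R K" if LU: "L \<in> U" for L
    proof -
      obtain x where x: "I * L + L * I = x *\<^sub>R e" using anti[OF 3(1) LU] by blast
      obtain y where y: "J * L + L * J = y *\<^sub>R e" using anti[OF J(1) LU] by blast
      obtain z where z: "K * L + L * K = z *\<^sub>R e" using anti[OF KU LU] by blast
      \<comment> \<open>The same correction for all three units makes M anticommute with I, J and K.
        But anticommuting with I and J means commuting with K = I J, so K M = 0, and K K = - e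
        yields M = 0. Hence \<open>U\<close> has no fourth direction.\<close>
      define M where "M = L + ((x / 2) *\<^sub>R I + (y / 2) *\<^sub>R J + (z / 2) *\<^sub>R K)"
      have "I * M + M * I = (I * L - (x / 2) *\<^sub>R e) + (L * I - (x / 2) *\<^sub>R e)"
        by (simp add: M_def distrib_left distrib_right IJ_rules)
      then have "I * M + M * I = 0"
        by (simp only: half x right_minus_eq)
      then have MI: "M * I = - (I * M)"
        by (simp add: add_eq_0_iff)
      have "J * M + M * J = (J * L - (y / 2) *\<^sub>R e) + (L * J - (y / 2) *\<^sub>R e)"
        by (simp add: M_def distrib_left distrib_right IJ_rules)
      then have "J * M + M * J = 0"
        by (simp only: half y right_minus_eq)
      then have MJ: "M * J = - (J * M)"
        by (simp add: add_eq_0_iff)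
      have "K * M + M * K = (K * L - (z / 2) *\<^sub>R e) + (L * K - (z / 2) *\<^sub>R e)"
        by (simp add: M_def distrib_left distrib_right IJ_rules)
      then have "K * M + M * K = 0"
        by (simp only: half z right_minus_eq)
      then have MK: "M * K = - (K * M)"
        by (simp add: add_eq_0_iff)
      have "M * K = (M * I) * J"
        by (simp add: K_def mult.assoc)
      also have "\<dots> = K * M"
        by (simp add: MI mult.assoc MJ K_def)
      finally have "K * M = - (K * M)"
        using MK by simp
      then have "(2::real) *\<^sub>R (K * M) = 0"
        by (metis add.right_inverse scaleR_2)
      then have "K * M = 0"
        by simp
      then have "K * K * M = 0"
        by (simp add: mult.assoc)
      moreover have "M \<in> U"
        unfolding M_def using LU 3(1) J(1) KU U_add U_scale by metis
      ultimately have "M = 0"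
        by (simp add: IJ_rules Ue)
      then have "L = (- x / 2) *\<^sub>R I + (- y / 2) *\<^sub>R J + (- z / 2) *\<^sub>R K"
        by (simp add: M_def add_eq_0_iff2)
      then show ?thesis
        by blast
    qed
    note rel = quaternion_relations_mult[OF e(3) Ue(2)[OF 3(1)] Ue(1)[OF 3(1)] Ue(2)[OF J(1)]
        Ue(1)[OF J(1)] Ue(2)[OF KU] Ue(1)[OF KU] IJ_rules]
    show thesis
    proof (rule that[of "\<psi> I J K" UNIV])
      have "\<exists>q\<in>UNIV. A * e = \<psi> I J K q" if A: "A \<in> R" for A
      proof -
        obtain t u where tu: "u \<in> U" "A * e = t *\<^sub>R e + u"
          using decomp[OF A] by blast
        then obtain x y z where "u = x *\<^sub>R I + y *\<^sub>R J + z *\<^sub>R K"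
          using span by blast
        then show ?thesis
          using tu by (intro bexI[of _ "Quat t x y z"]) (auto simp: \<psi>_def)
      qed
      then show "\<forall>A\<in>R. \<exists>q\<in>UNIV. A * e = \<psi> I J K q"
        by blast
      show "\<forall>p\<in>UNIV. \<forall>q\<in>UNIV. p * q \<in> UNIV \<and> \<psi> I J K (p * q) = \<psi> I J K p * \<psi> I J K q"
        by (simp only: \<psi>_def rel quat_sel_simps UNIV_I simp_thms ball_simps)
    qed (simp_all add: lin psi1 psi_cnj[OF 3(1) J(1) KU])
  qed
qed

lemma fa_eval_vanishing_ideal:
  assumes X: "\<And>a. X a \<in> R" "\<And>a. X (letter_star a) = st (X a)"
    and T: "fa_eval X p \<in> R" and p: "p \<in> vanishing_ideal"
  shows "fa_eval X p = 0"
proof (rule ccontr)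
  assume ne: "fa_eval X p \<noteq> 0"
  let ?T = "fa_eval X p"
  have "st ?T * ?T \<in> Sym"
    using T by (simp add: Sym_def mult_mem st_mem st_mult st_st)
  moreover have "st ?T * ?T \<noteq> 0"
    using st_mult_self_eq_0[OF T] ne by blast
  ultimately obtain e where e: "e \<in> Sym" "e \<noteq> 0" "e * e = e" "st ?T * ?T * e \<noteq> 0"
    "\<forall>z\<in>Sym. \<exists>c. z * e = c *\<^sub>R e"
    using minimal_idempotent_exists by blast
  obtain \<psi> Q where psi: "linear \<psi>" "\<psi> 1 = e" "1 \<in> Q"
    "\<forall>p\<in>Q. \<forall>q\<in>Q. p * q \<in> Q \<and> \<psi> (p * q) = \<psi> p * \<psi> q"
    "\<forall>q\<in>Q. qcnj q \<in> Q \<and> \<psi> (qcnj q) = st (\<psi> q)"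
    "\<forall>A\<in>R. \<exists>q\<in>Q. A * e = \<psi> q"
    using frobenius[OF e(1-3,5)] by blast
  have eR: "e \<in> R" "st e = e"
    using e by (auto simp: Sym_def)
  have eA: "e * A = A * e" if "A \<in> R" for A
    using Sym_commute e(1) that by blast
  \<comment> \<open>The quaternions representing \<open>X (Lq i) * e\<close> are the coordinates of
    the point. The letters \<open>Lqbar i\<close> then fit as well, because \<psi> carries
    \<open>qcnj\<close> on \<open>Q\<close> to \<open>st\<close>.\<close>
  have "\<forall>i. \<exists>q. q \<in> Q \<and> X (Lq i) * e = \<psi> q"
    using psi(6) X(1) by blast
  then obtain a where a: "\<And>i. a i \<in> Q" "\<And>i. X (Lq i) * e = \<psi> (a i)"
    by metis
  have letter: "letter_val a l \<in> Q \<and> X l * e = \<psi> (letter_val a l)" for l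
  proof (cases l)
    case (Lq i)
    then show ?thesis using a by simp
  next
    case (Lqbar i)
    have "X l * e = st (X (Lq i)) * e"
      using X(2)[of "Lq i"] Lqbar by simp
    also have "\<dots> = st (X (Lq i) * e)"
      using X(1) eR by (simp add: st_mult eA st_mem)
    finally show ?thesis
      using Lqbar bspec[OF psi(5) a(1)] a(2) by simp
  qed
  have word: "prod_list (map (letter_val a) w) \<in> Q \<and>
      prod_list (map X w) * e = \<psi> (prod_list (map (letter_val a) w))" for w
  proof (induction w)
    case Nil
    then show ?case using psi by simp
  next
    case (Cons l w)
    \<comment> \<open>A central idempotent moves past the rest of the word, and its two copies merge
      into one.\<close>
    have "\<psi> (letter_val a l * prod_list (map (letter_val a) w)) = X l * e * (prod_list (map X w) * e)"
      using psi(4) letter Cons by metis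
    also have "\<dots> = X l * (e * prod_list (map X w)) * e"
      by (simp add: mult.assoc)
    also have "e * prod_list (map X w) = prod_list (map X w) * e"
      by (rule eA) (induction w, auto intro: one_mem mult_mem X)
    finally have "\<psi> (letter_val a l * prod_list (map (letter_val a) w)) = prod_list (map X (l # w)) * e"
      by (simp only: mult.assoc e list.map prod_list.Cons)
    moreover have "letter_val a l * prod_list (map (letter_val a) w) \<in> Q"
      using psi(4) letter Cons by blast
    ultimately show ?case
      by simp
  qed
  \<comment> \<open>The coefficients of p are real and \<psi> is real-linear, so the word formula
    extends to all of p.\<close>
  have "?T * e = \<psi> (fa_eval (letter_val a) p)"
    unfolding fa_eval_def
    by (simp add: sum_distrib_right word linear_sum[OF psi(1)] linear_scale[OF psi(1)])
  also have "\<dots> = 0"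
    using p linear_0[OF psi(1)] by (simp add: vanishing_ideal_def)
  finally show False
    using e(4) by (simp add: mult.assoc)
qed

end

section \<open>Evaluation of the free algebra\<close>

lemma free_alg_sum_single: "p = (\<Sum>w\<in>Poly_Mapping.keys p. Poly_Mapping.single w (Poly_Mapping.lookup p w))"
  by (rule poly_mapping_eqI)
     (auto simp: lookup_sum lookup_single when_def sum.delta in_keys_iff)

lemma fa_eval_superset:
  assumes "finite S" "Poly_Mapping.keys p \<subseteq> S"
  shows "fa_eval X p = (\<Sum>w\<in>S. Poly_Mapping.lookup p w *\<^sub>R prod_list (map X w))"
  unfolding fa_eval_def by (rule sum.mono_neutral_left) (use assms in \<open>auto simp: in_keys_iff\<close>)

lemma fa_eval_zero [simp]: "fa_eval X 0 = 0"
  by (simp add: fa_eval_def)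

lemma fa_eval_single: "fa_eval X (Poly_Mapping.single w c) = c *\<^sub>R prod_list (map X w)"
  by (simp add: fa_eval_def)

lemma fa_eval_add: "fa_eval X (p + q) = fa_eval X p + fa_eval X q"
proof -
  let ?S = "Poly_Mapping.keys p \<union> Poly_Mapping.keys q"
  have "Poly_Mapping.keys (p + q) \<subseteq> ?S"
    by (rule keys_add)
  then show ?thesis
    by (simp add: fa_eval_superset[of ?S] lookup_add scaleR_add_left sum.distrib)
qed

lemma fa_eval_diff: "fa_eval X (p - q) = fa_eval X p - fa_eval X q"
  using fa_eval_add[of X "p - q" q] by simp

lemma fa_eval_sum: "fa_eval X (\<Sum>i\<in>I. f i) = (\<Sum>i\<in>I. fa_eval X (f i))"
  by (induction I rule: infinite_finite_induct) (simp_all add: fa_eval_add)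

lemma fa_eval_mult:
  fixes X :: "'n letter \<Rightarrow> 'b::{real_algebra, monoid_mult}"
  shows "fa_eval X (p * q) = fa_eval X p * fa_eval X q"
proof -
  have "p * q = (\<Sum>u\<in>Poly_Mapping.keys p. \<Sum>w\<in>Poly_Mapping.keys q.
      Poly_Mapping.single (u @ w) (Poly_Mapping.lookup p u * Poly_Mapping.lookup q w))"
    by (subst (1) free_alg_sum_single[of p], subst (1) free_alg_sum_single[of q])
       (simp add: sum_product mult_single plus_list_def)
  then show ?thesis
    by (simp add: fa_eval_sum fa_eval_single fa_eval_def[of X p] fa_eval_def[of X q] sum_product mult.commute)
qed

section \<open>The involution of the free algebra and its evaluations\<close>

lemma word_star_Cons: "word_star (a # w) = word_star w @ [letter_star a]"
  by (simp add: word_star_def)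

lemma letter_star_letter_star [simp]: "letter_star (letter_star a) = a"
  by (cases a) simp_all

definition free_alg_star :: "'n free_alg \<Rightarrow> 'n free_alg" where
  "free_alg_star p = (\<Sum>w\<in>Poly_Mapping.keys p. Poly_Mapping.single (word_star w) (Poly_Mapping.lookup p w))"

text \<open>Being adjoint is treated as a relation, since \<open>qadj A\<close> is a junk value for an operator \<open>A\<close> that
  has no adjoint.\<close>
lemma fa_eval_star_rel:
  fixes X :: "'n letter \<Rightarrow> 'b::{real_algebra, monoid_mult}"
  assumes "rel 0 0" "rel 1 1"
    and add: "\<And>A B A' B'. rel A A' \<Longrightarrow> rel B B' \<Longrightarrow> rel (A + B) (A' + B')"
    and scale: "\<And>A A' c. rel A A' \<Longrightarrow> rel (c *\<^sub>R A) (c *\<^sub>R A')"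
    and mult: "\<And>A B A' B'. rel A A' \<Longrightarrow> rel B B' \<Longrightarrow> rel (A * B) (B' * A')"
    and letter: "\<And>a. rel (X a) (X (letter_star a))"
  shows "rel (fa_eval X p) (fa_eval X (free_alg_star p))"
proof -
  have word: "rel (prod_list (map X w)) (prod_list (map X (word_star w)))" for w
  proof (induction w)
    case Nil
    then show ?case using assms by (simp add: word_star_def)
  next
    case (Cons a w)
    then show ?case using mult[OF letter Cons] by (simp add: word_star_Cons)
  qed
  have "rel (\<Sum>w\<in>W. Poly_Mapping.lookup p w *\<^sub>R prod_list (map X w))
      (\<Sum>w\<in>W. Poly_Mapping.lookup p w *\<^sub>R prod_list (map X (word_star w)))" if "finite W" for W
    using that by induction (auto intro: assms word)
  then show ?thesis
    by (simp add: fa_eval_def[of X p] free_alg_star_def fa_eval_sum fa_eval_single)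
qed

lemma qcnj_add: "qcnj (p + q) = qcnj p + qcnj q"
  and qcnj_scaleR: "qcnj (c *\<^sub>R p) = c *\<^sub>R qcnj p"
  and qcnj_mult: "qcnj (p * q) = qcnj q * qcnj p"
  and qcnj_qcnj [simp]: "qcnj (qcnj p) = p"
  and qcnj_zero [simp]: "qcnj 0 = 0"
  and qcnj_one [simp]: "qcnj 1 = 1"
  by (simp_all add: quat_eq_iff algebra_simps)

lemma qcnj_of_real [simp]: "qcnj (of_real c) = of_real c"
  by (simp add: of_real_def qcnj_scaleR)

lemma fa_eval_letter_val_star:
  "fa_eval (letter_val a) (free_alg_star p) = qcnj (fa_eval (letter_val a) p)"
proof (rule fa_eval_star_rel[where rel = "\<lambda>x y. y = qcnj x"])
  show "letter_val a (letter_star l) = qcnj (letter_val a l)" for l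
    by (cases l) simp_all
qed (simp_all add: qcnj_add qcnj_scaleR qcnj_mult)

text \<open>The sum is twice the real part of p, and reals are central. This is what makes
  symmetrized commutators vanish at every point.\<close>

lemma add_qcnj_commute: "(p + qcnj p) * q = q * (p + qcnj p)"
  by (simp add: quat_eq_iff algebra_simps)

lemma symmetrized_commutator_vanishing:
  "(p + free_alg_star p) * q - q * (p + free_alg_star p) \<in> vanishing_ideal"
  by (simp add: vanishing_ideal_def fa_eval_diff fa_eval_mult fa_eval_add fa_eval_letter_val_star
      add_qcnj_commute)

section \<open>Linear algebra over the quaternions\<close>

lemma qscale_zero_right [simp]: "x *\<^sub>H 0 = (0 :: 'v::rquat_space)"
  using qscale_add_right[of x 0 0] by simp

lemma qscale_minus_right: "x *\<^sub>H (- a) = - (x *\<^sub>H a)" for x :: "'v::rquat_space"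
  using qscale_add_right[of x a "- a"] by (simp add: eq_neg_iff_add_eq_0 add.commute)

lemma qscale_diff_left: "(x - y) *\<^sub>H a = x *\<^sub>H a - y *\<^sub>H a" for x :: "'v::rquat_space"
  by (simp only: diff_conv_add_uminus qscale_add_left qscale_minus_left)

lemma qscale_diff_right: "x *\<^sub>H (a - b) = x *\<^sub>H a - x *\<^sub>H b" for x :: "'v::rquat_space"
  by (simp only: diff_conv_add_uminus qscale_add_right qscale_minus_right)

lemma qscale_sum_left: "(\<Sum>i\<in>I. f i) *\<^sub>H a = (\<Sum>i\<in>I. f i *\<^sub>H a)" for f :: "_ \<Rightarrow> 'v::rquat_space"
  by (induction I rule: infinite_finite_induct) (simp_all add: qscale_add_left)

lemma qscale_sum_right: "x *\<^sub>H (\<Sum>i\<in>I. f i) = (\<Sum>i\<in>I. x *\<^sub>H f i)" for x :: "'v::rquat_space"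
  by (induction I rule: infinite_finite_induct) (simp_all add: qscale_add_right)

definition rsubspace :: "'v::rquat_space set \<Rightarrow> bool" where
  "rsubspace V \<longleftrightarrow> 0 \<in> V \<and> (\<forall>x\<in>V. \<forall>y\<in>V. x + y \<in> V) \<and> (\<forall>x\<in>V. \<forall>a. x *\<^sub>H a \<in> V)"

lemma rsubspace_sum: "rsubspace V \<Longrightarrow> (\<And>i. i \<in> I \<Longrightarrow> f i \<in> V) \<Longrightarrow> (\<Sum>i\<in>I. f i) \<in> V"
  by (induction I rule: infinite_finite_induct) (auto simp: rsubspace_def)

lemma rsubspace_diff:
  assumes "rsubspace V" "x \<in> V" "y \<in> V"
  shows "x - y \<in> V"
proof -
  have "x + y *\<^sub>H (- 1) \<in> V"
    using assms by (simp add: rsubspace_def)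
  then show ?thesis
    by (simp add: qscale_minus_right qscale_one)
qed

lemma rspan_finite:
  assumes "finite S"
  shows "rspan S = {\<Sum>x\<in>S. x *\<^sub>H c x | c. True}"
proof -
  have "\<exists>c'. (\<Sum>x\<in>T. x *\<^sub>H c x) = (\<Sum>x\<in>S. x *\<^sub>H c' x)" if "T \<subseteq> S" for T c
  proof -
    have "(\<Sum>x\<in>T. x *\<^sub>H c x) = (\<Sum>x\<in>S. x *\<^sub>H (if x \<in> T then c x else 0))"
      using assms that by (intro sum.mono_neutral_cong_left) auto
    then show ?thesis
      by (intro exI[of _ "\<lambda>x. if x \<in> T then c x else 0"])
  qed
  then show ?thesis
    using assms unfolding rspan_def by blast
qed

lemma rspan_sumI: "finite T \<Longrightarrow> T \<subseteq> S \<Longrightarrow> (\<Sum>x\<in>T. x *\<^sub>H c x) \<in> rspan S"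
  unfolding rspan_def by auto

lemma rsubspace_rspan: "rsubspace (rspan S)"
proof -
  have "0 \<in> rspan S"
    unfolding rspan_def by (auto intro!: exI[of _ "{}"])
  moreover have "x + y \<in> rspan S" if xy: "x \<in> rspan S" "y \<in> rspan S" for x y
  proof -
    obtain T c T' c' where T: "finite T" "T \<subseteq> S" "x = (\<Sum>z\<in>T. z *\<^sub>H c z)"
      and T': "finite T'" "T' \<subseteq> S" "y = (\<Sum>z\<in>T'. z *\<^sub>H c' z)"
      using xy unfolding rspan_def by blast
    have "x = (\<Sum>z\<in>T \<union> T'. z *\<^sub>H (if z \<in> T then c z else 0))"
      unfolding T using T(1) T'(1) by (intro sum.mono_neutral_cong_left) auto
    moreover have "y = (\<Sum>z\<in>T \<union> T'. z *\<^sub>H (if z \<in> T' then c' z else 0))"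
      unfolding T' using T(1) T'(1) by (intro sum.mono_neutral_cong_left) auto
    ultimately have "x + y = (\<Sum>z\<in>T \<union> T'. z *\<^sub>H ((if z \<in> T then c z else 0) + (if z \<in> T' then c' z else 0)))"
      by (simp only: qscale_add_right sum.distrib)
    then show ?thesis
      using T(1,2) T'(1,2) by (simp only: rspan_sumI Un_least finite_UnI)
  qed
  moreover have "x *\<^sub>H a \<in> rspan S" if x: "x \<in> rspan S" for x a
  proof -
    obtain T c where T: "finite T" "T \<subseteq> S" "x = (\<Sum>z\<in>T. z *\<^sub>H c z)"
      using x unfolding rspan_def by blast
    then have "x *\<^sub>H a = (\<Sum>z\<in>T. z *\<^sub>H (c z * a))"
      by (simp add: qscale_sum_left qscale_qscale)
    then show ?thesis
      using T(1,2) by (simp only: rspan_sumI)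
  qed
  ultimately show ?thesis
    by (simp add: rsubspace_def)
qed

lemma rspan_base: "x \<in> S \<Longrightarrow> x \<in> rspan S"
  unfolding rspan_def by (auto intro!: exI[of _ "{x}"] exI[of _ "\<lambda>_. 1"] simp: qscale_one)

lemma rspan_minimal: "S \<subseteq> V \<Longrightarrow> rsubspace V \<Longrightarrow> rspan S \<subseteq> V"
  unfolding rspan_def by (auto intro!: rsubspace_sum simp: rsubspace_def)

lemma rspan_mono: "S \<subseteq> T \<Longrightarrow> rspan S \<subseteq> rspan T"
  by (rule rspan_minimal) (auto intro: rspan_base rsubspace_rspan)

lemma rindep_finite:
  assumes "finite S"
  shows "rindep S \<longleftrightarrow> (\<forall>c. (\<Sum>x\<in>S. x *\<^sub>H c x) = 0 \<longrightarrow> (\<forall>x\<in>S. c x = 0))"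
proof
  assume *: "\<forall>c. (\<Sum>x\<in>S. x *\<^sub>H c x) = 0 \<longrightarrow> (\<forall>x\<in>S. c x = 0)"
  have "\<forall>x\<in>T. c x = 0" if "T \<subseteq> S" "(\<Sum>x\<in>T. x *\<^sub>H c x) = 0" for T c
  proof -
    have "(\<Sum>x\<in>T. x *\<^sub>H c x) = (\<Sum>x\<in>S. x *\<^sub>H (if x \<in> T then c x else 0))"
      using assms that by (intro sum.mono_neutral_cong_left) auto
    then have "\<forall>x\<in>S. (if x \<in> T then c x else 0) = 0"
      using *[THEN spec, of "\<lambda>x. if x \<in> T then c x else 0"] that(2) by simp
    then show ?thesis
      using that(1) by (meson subsetD)
  qed
  then show "rindep S"
    unfolding rindep_def by blast
qed (use assms in \<open>auto simp: rindep_def\<close>)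

lemma rindep_subset: "rindep S \<Longrightarrow> T \<subseteq> S \<Longrightarrow> rindep T"
  unfolding rindep_def by blast

lemma rspan_insert:
  assumes "x \<in> rspan (insert t T)"
  shows "\<exists>a w. w \<in> rspan T \<and> x = t *\<^sub>H a + w"
proof -
  let ?V = "{t *\<^sub>H a + w | a w. w \<in> rspan T}"
  have "rsubspace ?V"
    unfolding rsubspace_def
  proof (intro conjI ballI allI)
    show "0 \<in> ?V"
      using rsubspace_rspan[of T] by (auto simp: rsubspace_def intro!: exI[of _ 0])
    show "x + y \<in> ?V" if xy: "x \<in> ?V" "y \<in> ?V" for x y
    proof -
      obtain a w a' w' where *: "x = t *\<^sub>H a + w" "w \<in> rspan T" "y = t *\<^sub>H a' + w'" "w' \<in> rspan T"
        using xy by blast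
      then have "x + y = t *\<^sub>H (a + a') + (w + w')"
        by (simp add: qscale_add_right)
      then show ?thesis
        using * rsubspace_rspan[of T] unfolding rsubspace_def by blast
    qed
    show "x *\<^sub>H b \<in> ?V" if xV: "x \<in> ?V" for x b
    proof -
      obtain a w where *: "x = t *\<^sub>H a + w" "w \<in> rspan T"
        using xV by blast
      then have "x *\<^sub>H b = t *\<^sub>H (a * b) + w *\<^sub>H b"
        by (simp add: qscale_add_left qscale_qscale)
      then show ?thesis
        using * rsubspace_rspan[of T] unfolding rsubspace_def by blast
    qed
  qed
  moreover have "insert t T \<subseteq> ?V"
  proof
    fix s assume s: "s \<in> insert t T"
    have "0 \<in> rspan T"
      using rsubspace_rspan[of T] by (simp add: rsubspace_def)
    moreover have "t = t *\<^sub>H 1 + 0"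
      by (simp add: qscale_one)
    moreover have "s = t *\<^sub>H 0 + s"
      by simp
    ultimately show "s \<in> ?V"
      using s rspan_base[of s T] by blast
  qed
  ultimately show ?thesis
    using assms rspan_minimal by blast
qed

text \<open>Steinitz bound by Gaussian elimination of one vector t of the spanning set at a time.
  Working with indexed families avoids an injectivity argument for the family that remains after
  elimination.\<close>

lemma independent_family_card_le:
  fixes f :: "'i \<Rightarrow> 'v::rquat_space"
  assumes "finite T" "finite I" "f ` I \<subseteq> rspan T"
    and "\<And>c. (\<Sum>i\<in>I. f i *\<^sub>H c i) = 0 \<Longrightarrow> \<forall>i\<in>I. c i = 0"
  shows "card I \<le> card T"
  using assms
proof (induction T arbitrary: I f rule: finite_induct)
  case empty
  have "rspan {} = {0 :: 'v}"
    by (simp add: rspan_finite)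
  then have "\<forall>i\<in>I. f i = 0"
    using empty by auto
  \<comment> \<open>All members are zero, so constant coefficients 1 form a relation; independence
    then makes I empty.\<close>
  then have "\<forall>i\<in>I. (1::quat) = 0"
    by (intro empty(3)) simp
  then show ?case
    by auto
next
  case (insert t T)
  have "\<forall>i\<in>I. \<exists>a w. w \<in> rspan T \<and> f i = t *\<^sub>H a + w"
    using insert(5) rspan_insert by blast
  then obtain a w where aw: "\<And>i. i \<in> I \<Longrightarrow> w i \<in> rspan T" "\<And>i. i \<in> I \<Longrightarrow> f i = t *\<^sub>H a i + w i"
    by metis
  show ?case
  proof (cases "\<forall>i\<in>I. a i = 0")
    case True
    then have "f ` I \<subseteq> rspan T"
      using aw by auto
    from insert.IH[OF insert(4) this insert(6)] show ?thesis
      using insert.hyps by simp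
  next
    case False
    then obtain k where k: "k \<in> I" "a k \<noteq> 0"
      by blast
    \<comment> \<open>The pivot f k removes t from every other member. Scalars act on the right, so
      the inverse of the pivot coefficient must stand to the left of \<open>a i\<close>.\<close>
    define g where "g i = f i - f k *\<^sub>H (inverse (a k) * a i)" for i
    have "card (I - {k}) \<le> card T"
    proof (rule insert.IH[of _ g])
      show "g ` (I - {k}) \<subseteq> rspan T"
      proof
        fix x assume "x \<in> g ` (I - {k})"
        then obtain i where i: "i \<in> I" "x = g i"
          by blast
        have "a k * (inverse (a k) * a i) = a i"
          using k(2) by (simp flip: mult.assoc)
        then have "g i = w i - w k *\<^sub>H (inverse (a k) * a i)"
          using aw(2)[OF i(1)] aw(2)[OF k(1)] by (simp add: g_def qscale_add_left qscale_qscale)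
        moreover have "w k *\<^sub>H (inverse (a k) * a i) \<in> rspan T"
          using aw(1)[OF k(1)] rsubspace_rspan[of T] by (simp add: rsubspace_def)
        ultimately show "x \<in> rspan T"
          using rsubspace_diff[OF rsubspace_rspan] aw(1)[OF i(1)] i by metis
      qed
      show "\<forall>i\<in>I - {k}. c i = 0" if c: "(\<Sum>i\<in>I - {k}. g i *\<^sub>H c i) = 0" for c
      proof -
        \<comment> \<open>Collects the multiples of f k hidden in the g i: a relation among the g i
          becomes one among the f i with coefficient - b at k.\<close>
        define b where "b = (\<Sum>i\<in>I - {k}. inverse (a k) * a i * c i)"
        have "(\<Sum>i\<in>I - {k}. f i *\<^sub>H c i) - f k *\<^sub>H b = 0"
          using c by (simp add: g_def b_def qscale_diff_left sum_subtractf qscale_qscale qscale_sum_right)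
        moreover have "(\<Sum>i\<in>I. f i *\<^sub>H (if i = k then - b else c i)) =
            f k *\<^sub>H (- b) + (\<Sum>i\<in>I - {k}. f i *\<^sub>H c i)"
          using insert(4) k(1) by (subst sum.remove[of _ k]) (auto intro!: sum.cong)
        ultimately have "(\<Sum>i\<in>I. f i *\<^sub>H (if i = k then - b else c i)) = 0"
          by (simp add: qscale_minus_right)
        from insert(6)[OF this] show ?thesis
          by (metis DiffE insertI1)
      qed
    qed (use insert in auto)
    then show ?thesis
      using insert k by simp
  qed
qed

lemma rindep_card_le:
  assumes "finite T" "rindep S" "S \<subseteq> rspan T"
  shows "finite S \<and> card S \<le> card T"
proof -
  have *: "card F \<le> card T" if "finite F" "F \<subseteq> S" for F
    using independent_family_card_le[of T F "\<lambda>x. x"] assms that rindep_finite[of F] rindep_subset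
    by auto
  have "finite S"
    using * by (metis finite_if_finite_subsets_card_bdd)
  then show ?thesis
    using * by blast
qed

lemma rbasis_exists:
  fixes S :: "'v::rquat_space set"
  assumes "finite S"
  obtains B where "B \<subseteq> S" "finite B" "rindep B" "rspan B = rspan S"
proof -
  obtain B where B: "B \<subseteq> S \<and> rspan B = rspan S"
    and least: "\<And>C. C \<subseteq> S \<and> rspan C = rspan S \<Longrightarrow> card B \<le> card C"
    using ex_has_least_nat[of "\<lambda>B. B \<subseteq> S \<and> rspan B = rspan S" S card] by blast
  have fin: "finite B"
    using B assms finite_subset by blast
  have "rindep B"
  proof (rule ccontr)
    assume "\<not> rindep B"
    then obtain c x where c: "(\<Sum>x\<in>B. x *\<^sub>H c x) = 0" and x: "x \<in> B" "c x \<noteq> 0"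
      unfolding rindep_finite[OF fin] by blast
    have "x *\<^sub>H c x + (\<Sum>z\<in>B - {x}. z *\<^sub>H c z) = 0"
      using c x fin by (simp add: sum.remove)
    then have "x *\<^sub>H c x = - (\<Sum>z\<in>B - {x}. z *\<^sub>H c z)"
      by (simp add: eq_neg_iff_add_eq_0)
    then have "x *\<^sub>H c x *\<^sub>H inverse (c x) = (\<Sum>z\<in>B - {x}. z *\<^sub>H (- (c z * inverse (c x))))"
      by (simp add: qscale_minus_left qscale_sum_left qscale_qscale qscale_minus_right sum_negf)
    then have xeq: "x = (\<Sum>z\<in>B - {x}. z *\<^sub>H (- (c z * inverse (c x))))"
      using x by (simp add: qscale_qscale qscale_one)
    have "(\<Sum>z\<in>B - {x}. z *\<^sub>H (- (c z * inverse (c x)))) \<in> rspan (B - {x})"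
      using fin by (intro rspan_sumI) auto
    then have "x \<in> rspan (B - {x})"
      by (simp only: xeq[symmetric])
    then have "B \<subseteq> rspan (B - {x})"
      using rspan_base[of _ "B - {x}"] by fastforce
    then have "rspan B \<subseteq> rspan (B - {x})"
      by (rule rspan_minimal[OF _ rsubspace_rspan])
    then have "rspan (B - {x}) = rspan B"
      using rspan_mono[of "B - {x}" B] by auto
    then have "card B \<le> card (B - {x})"
      using least B by blast
    then show False
      using fin x by (metis card_Diff1_less not_less)
  qed
  then show thesis
    using that B fin by blast
qed

text \<open>The basis picked by \<open>SOME\<close> is first shown to be finite; then it and B bound
  each other's size.\<close>

lemma rdim_eq_card:
  assumes "finite B" "rindep B" "rspan B = rspan S"
  shows "rdim S = card B"
proof -
  define C where "C = (SOME B. rindep B \<and> rspan B = rspan S)"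
  have C: "rindep C" "rspan C = rspan S"
    unfolding C_def using assms someI[of "\<lambda>B. rindep B \<and> rspan B = rspan S" B] by auto
  have "finite C \<and> card C \<le> card B"
    using rindep_card_le[OF assms(1) C(1)] C(2) assms(3) rspan_base by blast
  moreover from this have "card B \<le> card C"
    using rindep_card_le[of C B] assms C(2) rspan_base by blast
  ultimately show ?thesis
    by (simp add: rdim_def C_def)
qed

lemma rindep_insert:
  assumes "finite B" "rindep B" "x \<notin> rspan B"
  shows "rindep (insert x B)"
proof -
  have "c y = 0" if "(\<Sum>y\<in>insert x B. y *\<^sub>H c y) = 0" "y \<in> insert x B" for c y
  proof -
    have xB: "x \<notin> B"
      using assms(3) rspan_base by blast
    then have eq: "x *\<^sub>H c x + (\<Sum>z\<in>B. z *\<^sub>H c z) = 0"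
      using that(1) assms(1) by simp
    have "c x = 0"
    proof (rule ccontr)
      assume "c x \<noteq> 0"
      have "(\<Sum>z\<in>B. z *\<^sub>H c z) \<in> rspan B"
        using assms(1) by (rule rspan_sumI) simp
      then have "(\<Sum>z\<in>B. z *\<^sub>H c z) *\<^sub>H (- inverse (c x)) \<in> rspan B"
        using rsubspace_rspan[of B] unfolding rsubspace_def by blast
      moreover have "(\<Sum>z\<in>B. z *\<^sub>H c z) = - (x *\<^sub>H c x)"
        using eq by (metis add_eq_0_iff)
      ultimately show False
        using \<open>c x \<noteq> 0\<close> assms(3)
        by (simp add: qscale_minus_left qscale_minus_right qscale_qscale qscale_one)
    qed
    then show ?thesis
      using eq that(2) assms(1,2) rindep_finite[of B] by auto
  qed
  then show ?thesis
    using assms(1) by (subst rindep_finite) auto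
qed

text \<open>Turns the rank equality of flatness into a spanning statement: a vector outside the span
  of B would enlarge B to an independent set bigger than a basis.\<close>

lemma rspan_UNIV_if_rdim:
  fixes B :: "'v::rquat_space set"
  assumes "finite S" "rspan S = (UNIV :: 'v set)"
    and "finite B" "rindep B" "card B = rdim (UNIV :: 'v set)"
  shows "rspan B = UNIV"
proof (rule ccontr)
  assume "rspan B \<noteq> UNIV"
  then obtain x where x: "x \<notin> rspan B"
    by blast
  obtain C where C: "finite C" "rindep C" "rspan C = rspan S"
    using rbasis_exists[OF assms(1)] by metis
  have "rspan (UNIV :: 'v set) = UNIV"
    using rspan_base by blast
  then have "card C = card B"
    using rdim_eq_card[OF C(1,2), of UNIV] C(3) assms by simp
  moreover have "card (insert x B) \<le> card C"
    using rindep_card_le[OF C(1) rindep_insert[OF assms(3,4) x]] C(3) assms(2) by simp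
  moreover have "x \<notin> B"
    using x rspan_base by blast
  ultimately show False
    using assms(3) by simp
qed

section \<open>Right-linear operators and their values on a basis\<close>

lemma qapply_add: "qapply A (x + y) = qapply A x + qapply A y"
  and qapply_scale: "qapply A (x *\<^sub>H a) = qapply A x *\<^sub>H a"
  using qapply[of A] by auto

lemma qapply_zero [simp]: "qapply A 0 = 0"
  using qapply_add[of A 0 0] by simp

lemma qop_eqI: "(\<And>x. qapply A x = qapply B x) \<Longrightarrow> A = B"
  by (metis ext qapply_inject)

lemma qop_eqI_on_span:
  assumes "rspan S = UNIV" "\<And>x. x \<in> S \<Longrightarrow> qapply A x = qapply B x"
  shows "A = B"
proof (rule qop_eqI)
  fix x
  have "rspan S \<subseteq> {x. qapply A x = qapply B x}"
    using assms(2) by (intro rspan_minimal) (auto simp: rsubspace_def qapply_add qapply_scale)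
  then show "qapply A x = qapply B x"
    using assms(1) by blast
qed

text \<open>Coordinates are obtained by choice; their uniqueness makes the extension additive and
  right-linear and fixes its values on B.\<close>

lemma qop_extend:
  fixes g :: "'v::rquat_space \<Rightarrow> 'v"
  assumes B: "finite B" "rindep B" "rspan B = UNIV"
  obtains A where "\<And>b. b \<in> B \<Longrightarrow> qapply A b = g b"
proof -
  have "\<exists>c. x = (\<Sum>b\<in>B. b *\<^sub>H c b)" for x
    using B(3) rspan_finite[OF B(1)] by auto
  then obtain c where c: "\<And>x. x = (\<Sum>b\<in>B. b *\<^sub>H c x b)"
    by metis
  have uniq: "c x b = e b" if "x = (\<Sum>b\<in>B. b *\<^sub>H e b)" "b \<in> B" for x e b
  proof -
    have "(\<Sum>b\<in>B. b *\<^sub>H (c x b - e b)) = x - x"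
      by (simp only: qscale_diff_right sum_subtractf c[symmetric] that(1)[symmetric])
    then have "(\<Sum>b\<in>B. b *\<^sub>H (c x b - e b)) = 0"
      by simp
    then have "c x b - e b = 0"
      using rindep_finite[OF B(1), THEN iffD1, OF B(2), THEN spec, of "\<lambda>b. c x b - e b"] that(2) by blast
    then show ?thesis
      by simp
  qed
  define f where "f x = (\<Sum>b\<in>B. g b *\<^sub>H c x b)" for x
  have add: "f (x + y) = f x + f y" for x y
  proof -
    have "(\<Sum>b\<in>B. b *\<^sub>H (c x b + c y b)) = x + y"
      by (simp only: qscale_add_right sum.distrib c[symmetric])
    from uniq[OF this[symmetric]] show ?thesis
      by (simp add: f_def qscale_add_right sum.distrib)
  qed
  have scale: "f (x *\<^sub>H a) = f x *\<^sub>H a" for x a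
  proof -
    have "(\<Sum>b\<in>B. b *\<^sub>H (c x b * a)) = x *\<^sub>H a"
      by (simp only: qscale_qscale[symmetric] qscale_sum_left[symmetric] c[symmetric])
    from uniq[OF this[symmetric]] show ?thesis
      by (simp add: f_def qscale_sum_left qscale_qscale)
  qed
  have "f b = g b" if b: "b \<in> B" for b
  proof -
    have "b = (\<Sum>b'\<in>B. b' *\<^sub>H (if b' = b then 1 else 0))"
      using b B(1) by (simp add: if_distrib[of "\<lambda>a. _ *\<^sub>H a"] qscale_one cong: if_cong)
    from uniq[OF this] show ?thesis
      using b B(1) by (simp add: f_def if_distrib[of "\<lambda>a. _ *\<^sub>H a"] qscale_one cong: if_cong)
  qed
  then show thesis
    using that[of "Abs_qop f"] add scale by (simp add: Abs_qop_inverse)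
qed

section \<open>Real dimension of the operator algebra\<close>

lemma family_dim_UNIV:
  fixes f :: "'i \<Rightarrow> 'a::real_vector"
  assumes I: "finite I"
    and indep: "\<And>c. (\<Sum>i\<in>I. c i *\<^sub>R f i) = 0 \<Longrightarrow> \<forall>i\<in>I. c i = 0"
    and spans: "\<And>x. \<exists>c. x = (\<Sum>i\<in>I. c i *\<^sub>R f i)"
  shows "dim (UNIV :: 'a set) = card I" "span (f ` I) = UNIV"
proof -
  have inj: "inj_on f I"
  proof (rule inj_onI, rule ccontr)
    fix i j assume ij: "i \<in> I" "j \<in> I" "f i = f j" "i \<noteq> j"
    let ?c = "\<lambda>k. if k = i then 1 else if k = j then - 1 else 0 :: real"
    have "(\<Sum>k\<in>I. ?c k *\<^sub>R f k) = (\<Sum>k\<in>{i, j}. ?c k *\<^sub>R f k)"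
      using I ij by (intro sum.mono_neutral_right) auto
    also have "\<dots> = 0"
      using ij by simp
    finally show False
      using indep[of ?c] ij by auto
  qed
  have "independent (f ` I)"
  proof (rule independent_if_scalars_zero)
    show "c x = 0" if sum: "(\<Sum>x\<in>f ` I. c x *\<^sub>R x) = 0" and x: "x \<in> f ` I" for c x
    proof -
      have "(\<Sum>i\<in>I. c (f i) *\<^sub>R f i) = 0"
        using sum inj by (simp add: sum.reindex)
      then show ?thesis
        using indep[of "\<lambda>i. c (f i)"] x by blast
    qed
  qed (simp add: I)
  moreover have "x \<in> span (f ` I)" for x
    using spans[of x] by (auto intro!: span_sum span_scale intro: span_base)
  then show "span (f ` I) = UNIV"
    by blast
  ultimately show "dim (UNIV :: 'a set) = card I"
    using inj by (intro dim_unique[of "f ` I"]) (auto simp: card_image)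
qed

lemma qapply_simps [simp]:
  "qapply 0 x = 0" "qapply 1 x = x" "qapply (A + B) x = qapply A x + qapply B x"
  "qapply (A - B) x = qapply A x - qapply B x" "qapply (A * B) x = qapply A (qapply B x)"
  "qapply (c *\<^sub>R A) x = qapply A x *\<^sub>H of_real c"
  by (simp_all add: zero_qop.rep_eq one_qop.rep_eq plus_qop.rep_eq minus_qop.rep_eq
      times_qop.rep_eq scaleR_qop.rep_eq)

lemma qapply_sum_left: "qapply (\<Sum>i\<in>I. A i) x = (\<Sum>i\<in>I. qapply (A i) x)"
  by (induction I rule: infinite_finite_induct) simp_all

definition quat_unit :: "nat \<Rightarrow> quat" where
  "quat_unit k = (if k = 0 then Quat 1 0 0 0 else if k = 1 then Quat 0 1 0 0
     else if k = 2 then Quat 0 0 1 0 else Quat 0 0 0 1)"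

definition quat_coord :: "nat \<Rightarrow> quat \<Rightarrow> real" where
  "quat_coord k q = (if k = 0 then qRe q else if k = 1 then qI q else if k = 2 then qJ q else qK q)"

lemma less_4_cases: "k < 4 \<Longrightarrow> k = 0 \<or> k = 1 \<or> k = 2 \<or> k = (3::nat)"
  by auto

lemma sum_quat_unit: "(\<Sum>k<4. quat_unit k * of_real (c k)) = Quat (c 0) (c 1) (c 2) (c 3)"
  by (simp add: eval_nat_numeral lessThan_Suc quat_unit_def of_real_def quat_eq_iff)

lemma Quat_quat_coord: "Quat (quat_coord 0 q) (quat_coord 1 q) (quat_coord 2 q) (quat_coord 3 q) = q"
  by (simp add: quat_coord_def quat_eq_iff)

text \<open>Real matrix units: \<open>E b c k\<close> sends b to c times the k-th quaternion unit
  and the other basis vectors to 0, four operators for each pair (b, c). The finite spanning set is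
  stated separately, because a value of \<open>dim\<close> alone does not witness finite
  dimension.\<close>

lemma qop_dim:
  fixes B :: "'v::rquat_space set"
  assumes B: "finite B" "rindep B" "rspan B = UNIV"
  shows "dim (UNIV :: 'v qop set) = 4 * (card B)\<^sup>2"
    and "\<exists>Bs :: 'v qop set. finite Bs \<and> span Bs = UNIV"
proof -
  have "\<exists>E. \<forall>b'\<in>B. qapply E b' = (if b' = b then c *\<^sub>H quat_unit k else 0)" for b c and k :: nat
    using qop_extend[OF B, of "\<lambda>b'. if b' = b then c *\<^sub>H quat_unit k else 0"] by metis
  then obtain E :: "'v \<Rightarrow> 'v \<Rightarrow> nat \<Rightarrow> 'v qop" where
    E: "\<And>b c k b'. b' \<in> B \<Longrightarrow> qapply (E b c k) b' = (if b' = b then c *\<^sub>H quat_unit k else 0)"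
    by metis
  let ?I = "B \<times> B \<times> {..<4::nat}"
  let ?f = "\<lambda>(b, c, k). E b c k"
  have combination: "qapply (\<Sum>i\<in>?I. e i *\<^sub>R ?f i) b =
      (\<Sum>c\<in>B. c *\<^sub>H Quat (e (b, c, 0)) (e (b, c, 1)) (e (b, c, 2)) (e (b, c, 3)))"
    if b: "b \<in> B" for e b
  proof -
    have "qapply (\<Sum>i\<in>?I. e i *\<^sub>R ?f i) b =
        (\<Sum>b'\<in>B. \<Sum>c\<in>B. \<Sum>k<4. qapply (E b' c k) b *\<^sub>H of_real (e (b', c, k)))"
      by (simp add: qapply_sum_left sum.cartesian_product case_prod_unfold)
    also have "\<dots> = (\<Sum>b'\<in>B. if b = b' then \<Sum>c\<in>B. \<Sum>k<4. c *\<^sub>H quat_unit k *\<^sub>H of_real (e (b, c, k)) else 0)"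
      using b by (intro sum.cong) (auto simp: E)
    also have "\<dots> = (\<Sum>c\<in>B. \<Sum>k<4. c *\<^sub>H quat_unit k *\<^sub>H of_real (e (b, c, k)))"
      using b B(1) by simp
    also have "\<dots> = (\<Sum>c\<in>B. c *\<^sub>H (\<Sum>k<4. quat_unit k * of_real (e (b, c, k))))"
      by (simp only: qscale_qscale qscale_sum_right)
    finally show ?thesis
      by (simp only: sum_quat_unit)
  qed
  have fin: "finite ?I"
    using B(1) by simp
  have indep: "\<forall>i\<in>?I. e i = 0" if zero: "(\<Sum>i\<in>?I. e i *\<^sub>R ?f i) = 0" for e
  proof -
    have Q: "Quat (e (b, c, 0)) (e (b, c, 1)) (e (b, c, 2)) (e (b, c, 3)) = 0" if "b \<in> B" "c \<in> B" for b c
    proof -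
      have "(\<Sum>c\<in>B. c *\<^sub>H Quat (e (b, c, 0)) (e (b, c, 1)) (e (b, c, 2)) (e (b, c, 3))) = 0"
        using combination[OF that(1), of e] by (simp only: zero qapply_simps)
      then show ?thesis
        using rindep_finite[OF B(1), THEN iffD1, OF B(2), THEN spec,
            of "\<lambda>c. Quat (e (b, c, 0)) (e (b, c, 1)) (e (b, c, 2)) (e (b, c, 3))"] that(2) by blast
    qed
    show ?thesis
    proof
      fix i assume "i \<in> ?I"
      then obtain b c k where i: "i = (b, c, k)" "b \<in> B" "c \<in> B" "k < 4"
        by auto
      then show "e i = 0"
        using Q[OF i(2,3)] less_4_cases[OF i(4)] by (auto simp: quat_eq_iff)
    qed
  qed
  have spans: "\<exists>e. A = (\<Sum>i\<in>?I. e i *\<^sub>R ?f i)" for A :: "'v qop"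
  proof -
    have "\<exists>c. x = (\<Sum>b\<in>B. b *\<^sub>H c b)" for x
      using B(3) rspan_finite[OF B(1)] by auto
    then obtain c where c: "\<And>x. x = (\<Sum>b\<in>B. b *\<^sub>H c x b)"
      by metis
    define e where "e = (\<lambda>(b, b', k). quat_coord k (c (qapply A b) b'))"
    have "A = (\<Sum>i\<in>?I. e i *\<^sub>R ?f i)"
    proof (rule qop_eqI_on_span[OF B(3)])
      fix b assume "b \<in> B"
      then show "qapply A b = qapply (\<Sum>i\<in>?I. e i *\<^sub>R ?f i) b"
        by (simp only: combination e_def prod.case Quat_quat_coord c[symmetric])
    qed
    then show ?thesis
      by (intro exI[of _ e])
  qed
  have "card ?I = 4 * (card B)\<^sup>2"
    by (simp add: card_cartesian_product power2_eq_square)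
  then show "dim (UNIV :: 'v qop set) = 4 * (card B)\<^sup>2"
    using family_dim_UNIV(1)[OF fin indep spans] by simp
  show "\<exists>Bs :: 'v qop set. finite Bs \<and> span Bs = UNIV"
    using family_dim_UNIV(2)[OF fin indep spans] fin by blast
qed

section \<open>Adjoints\<close>

lemma qinner_zero_right [simp]: "qinner x 0 = 0"
  using qinner_add_right[of x 0 0] by simp

lemma qinner_diff_right: "qinner x (y - z) = qinner x y - qinner x z"
  using qinner_add_right[of x "y - z" z] by simp

lemma qinner_add_left: "qinner (x + y) z = qinner x z + qinner y z"
  by (metis qcnj_add qinner_add_right qinner_cnj)

lemma qinner_zero_left [simp]: "qinner 0 x = 0"
  using qinner_add_left[of 0 0 x] by simp

lemma qinner_scale_left: "qinner (x *\<^sub>H a) y = qcnj a * qinner x y"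
  by (metis qcnj_mult qinner_cnj qinner_scale_right)

text \<open>With its companion for the right argument, this reduces adjointness identities to a
  spanning set, one argument at a time.\<close>

lemma rsubspace_qinner_eq: "rsubspace {x. qinner (f x) y = qinner x z}"
  if "\<And>x y. f (x + y) = f x + f y" "\<And>x a. f (x *\<^sub>H a) = f x *\<^sub>H a"
  using that(1)[of 0 0] by (auto simp: rsubspace_def that qinner_add_left qinner_scale_left)

lemma rsubspace_qinner_right_eq: "rsubspace {y. qinner z y = qinner x (f y)}"
  if "\<And>x y. f (x + y) = f x + f y" "\<And>x a. f (x *\<^sub>H a) = f x *\<^sub>H a"
  using that(1)[of 0 0] by (auto simp: rsubspace_def that qinner_add_right qinner_scale_right)

lemma qinner_eqI:
  assumes "\<And>x. qinner x y = qinner x z"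
  shows "y = z"
  using qinner_eq_0[of "y - z"] assms[of "y - z"] by (simp add: qinner_diff_right)

lemma qinner_eqI_on_span:
  assumes "rspan S = UNIV" "\<And>x. x \<in> S \<Longrightarrow> qinner x y = qinner x z"
  shows "y = z"
proof (rule qinner_eqI)
  fix x
  have "rspan S \<subseteq> {x. qinner x y = qinner x z}"
    using assms(2) rsubspace_qinner_eq[of "\<lambda>x. x" y z] by (intro rspan_minimal) auto
  then show "qinner x y = qinner x z"
    using assms(1) by blast
qed

lemma eq_of_real_if_qcnj_eq: "qcnj q = q \<Longrightarrow> q = of_real (qRe q)"
  by (simp add: quat_eq_iff of_real_def)

lemma qinner_self_real: "qinner x x = of_real (qRe (qinner x x))"
  by (rule eq_of_real_if_qcnj_eq) (rule qinner_cnj[symmetric])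

definition adjoint_pair :: "'h::rquat_inner qop \<Rightarrow> 'h qop \<Rightarrow> bool" where
  "adjoint_pair A B \<longleftrightarrow> (\<forall>x y. qinner (qapply A x) y = qinner x (qapply B y))"

lemma qadj_eq:
  assumes "adjoint_pair A B"
  shows "qadj A = B"
  unfolding qadj_def
proof (rule the_equality)
  show "\<forall>x y. qinner (qapply A x) y = qinner x (qapply B y)"
    using assms by (simp add: adjoint_pair_def)
  fix C assume C: "\<forall>x y. qinner (qapply A x) y = qinner x (qapply C y)"
  have "qinner x (qapply C y) = qinner x (qapply B y)" for x y
    using assms C unfolding adjoint_pair_def by metis
  then show "C = B"
    by (intro qop_eqI qinner_eqI)
qed

lemma adjoint_pair_sym: "adjoint_pair A B \<Longrightarrow> adjoint_pair B A"
  unfolding adjoint_pair_def by (metis qinner_cnj)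

lemma adjoint_pair_zero: "adjoint_pair 0 0"
  and adjoint_pair_one: "adjoint_pair 1 1"
  and adjoint_pair_add: "adjoint_pair A A' \<Longrightarrow> adjoint_pair B B' \<Longrightarrow> adjoint_pair (A + B) (A' + B')"
  and adjoint_pair_mult: "adjoint_pair A A' \<Longrightarrow> adjoint_pair B B' \<Longrightarrow> adjoint_pair (A * B) (B' * A')"
  by (simp_all add: adjoint_pair_def qinner_add_left qinner_add_right)

lemma adjoint_pair_scaleR: "adjoint_pair A A' \<Longrightarrow> adjoint_pair (c *\<^sub>R A) (c *\<^sub>R A')"
  by (simp add: adjoint_pair_def qinner_scale_left qinner_scale_right of_real_quat_central)

text \<open>Pairing the sum applied to x with x gives the squared norms of A x and B x; both are
  nonnegative, so each is zero.\<close>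

lemma adjoint_pair_definite:
  assumes "adjoint_pair A A'" "adjoint_pair B B'" "A' * A + B' * B = 0"
  shows "A = 0"
proof (rule qop_eqI)
  fix x
  have "qinner x (qapply (A' * A + B' * B) x) = 0"
    by (simp only: assms(3) qapply_simps qinner_zero_right)
  then have "qinner (qapply A x) (qapply A x) + qinner (qapply B x) (qapply B x) = 0"
    using assms(1,2) by (simp add: qinner_add_right adjoint_pair_def)
  then have "qRe (qinner (qapply A x) (qapply A x)) + qRe (qinner (qapply B x) (qapply B x)) = 0"
    by (metis quat_sel_simps(1,9))
  then have "qRe (qinner (qapply A x) (qapply A x)) = 0"
    using qinner_nonneg[of "qapply A x"] qinner_nonneg[of "qapply B x"] by linarith
  then have "qapply A x = 0"
    using qinner_self_real[of "qapply A x"] qinner_eq_0 by simp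
  then show "qapply A x = qapply 0 x"
    by simp
qed

section \<open>The canonical flat representation\<close>

lemma finite_qwords: "finite (qwords t :: 'n::finite qword set)"
proof -
  have "a \<in> range Lq \<union> range Lqbar" for a :: "'n letter"
    by (cases a) auto
  then have "(UNIV :: 'n letter set) = range Lq \<union> range Lqbar"
    by blast
  then have "finite (UNIV :: 'n letter set)"
    by (metis finite_Un finite_class.finite_UNIV finite_imageI)
  from finite_lists_length_le[OF this, of t] show ?thesis
    by (simp add: qwords_def)
qed

text \<open>The column of w is the image of \<open>v w\<close> under the map \<open>G\<close> taking
  inner products with all \<open>v u\<close>. \<open>G\<close> is injective on their span, since a
  vector there that is orthogonal to every \<open>v u\<close> is orthogonal to itself. Hence the
  rank is the dimension of the span.\<close>

lemma qrank_gram: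
  fixes v :: "'i \<Rightarrow> 'h::rquat_inner"
  assumes I: "finite I" and M: "\<And>u w. u \<in> I \<Longrightarrow> w \<in> I \<Longrightarrow> M u w = qinner (v u) (v w)"
  obtains B where "finite B" "rindep B" "rspan B = rspan (v ` I)" "card B = qrank I M"
proof -
  define G where "G x = (\<lambda>u. if u \<in> I then qinner (v u) x else 0)" for x
  have G_add: "G (x + y) = G x + G y" and G_scale: "G (x *\<^sub>H a) = G x *\<^sub>H a" for x y a
    by (auto simp: G_def fun_eq_iff qscale_fun_def qscale_quat_def qinner_add_right qinner_scale_right)
  have G0: "G 0 = 0"
    by (auto simp: G_def)
  have G_sum: "G (\<Sum>x\<in>T. f x) = (\<Sum>x\<in>T. G (f x))" for f :: "'h \<Rightarrow> 'h" and T
    by (induction T rule: infinite_finite_induct) (simp_all add: G0 G_add)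
  have ker: "x = 0" if x: "x \<in> rspan (v ` I)" and G: "G x = 0" for x
  proof -
    have "qinner (v u) x = 0" if "u \<in> I" for u
      using fun_cong[OF G, of u] that by (simp add: G_def)
    then have "rspan (v ` I) \<subseteq> {z. qinner z x = qinner z 0}"
      using rsubspace_qinner_eq[of "\<lambda>z. z" x 0] by (intro rspan_minimal) auto
    then show ?thesis
      using x qinner_eq_0[of x] by auto
  qed
  obtain B where B: "B \<subseteq> v ` I" "finite B" "rindep B" "rspan B = rspan (v ` I)"
    using rbasis_exists[of "v ` I"] I by auto
  have G_diff: "G (x - y) = G x - G y" for x y
    using G_add[of "x - y" y] by (simp add: algebra_simps)
  have inj: "inj_on G (rspan (v ` I))"
  proof (rule inj_onI)
    fix x y assume xy: "x \<in> rspan (v ` I)" "y \<in> rspan (v ` I)" "G x = G y"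
    then have "x - y = 0"
      by (intro ker rsubspace_diff[OF rsubspace_rspan]) (simp_all add: G_diff)
    then show "x = y"
      by simp
  qed
  have B_span: "B \<subseteq> rspan (v ` I)"
    using B(1) rspan_base[of _ "v ` I"] by blast
  have injB: "inj_on G B"
    using inj B_span by (rule inj_on_subset)
  have "rindep (G ` B)"
  proof (subst rindep_finite, safe)
    fix c x assume c: "(\<Sum>x\<in>G ` B. x *\<^sub>H c x) = 0" and x: "x \<in> B"
    have "G (\<Sum>x\<in>B. x *\<^sub>H c (G x)) = 0"
      using c by (simp add: sum.reindex[OF injB] G_sum G_scale)
    moreover have "(\<Sum>x\<in>B. x *\<^sub>H c (G x)) \<in> rspan (v ` I)"
      using rspan_sumI[of B B "\<lambda>x. c (G x)"] B(2,4) by simp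
    ultimately have "(\<Sum>x\<in>B. x *\<^sub>H c (G x)) = 0"
      by (rule ker[rotated])
    then show "c (G x) = 0"
      using rindep_finite[OF B(2), THEN iffD1, OF B(3), THEN spec, of "\<lambda>x. c (G x)"] x by blast
  qed (use B in auto)
  moreover have "rspan (G ` B) = rspan (G ` v ` I)"
  proof
    show "rspan (G ` B) \<subseteq> rspan (G ` v ` I)"
      using B(1) by (intro rspan_mono image_mono)
    have "rsubspace {x. G x \<in> rspan (G ` B)}"
      using rsubspace_rspan[of "G ` B"] by (auto simp: rsubspace_def G0 G_add G_scale)
    then have "rspan B \<subseteq> {x. G x \<in> rspan (G ` B)}"
      by (intro rspan_minimal) (auto intro: rspan_base)
    then have "G ` v ` I \<subseteq> rspan (G ` B)"
      using B(4) rspan_base[of _ "v ` I"] by blast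
    then show "rspan (G ` v ` I) \<subseteq> rspan (G ` B)"
      by (rule rspan_minimal[OF _ rsubspace_rspan])
  qed
  ultimately have "rdim (G ` v ` I) = card (G ` B)"
    using B(2) by (intro rdim_eq_card) auto
  moreover have "(\<lambda>w u. if u \<in> I then M u w else 0) ` I = G ` v ` I"
    unfolding image_image by (intro image_cong) (auto simp: G_def M)
  ultimately have "card B = qrank I M"
    using injB by (simp add: qrank_def card_image)
  with that B show thesis
    by blast
qed

text \<open>This is where flatness enters: the smaller moment matrix is the Gram matrix of the
  shorter words, and its rank is already the dimension of the whole space.\<close>

lemma flat_span:
  fixes v :: "'n::finite qword \<Rightarrow> 'h::rquat_inner"
  assumes "qrank (qwords (d - 1)) (moment_matrix y) = r" "canonical_vectors d r y v"
  shows "rspan (v ` qwords (d - 1)) = UNIV"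
proof -
  have v: "rspan (v ` qwords d) = UNIV" "rdim (UNIV :: 'h set) = r"
    and gram: "\<And>u w. u \<in> qwords d \<Longrightarrow> w \<in> qwords d \<Longrightarrow> qinner (v u) (v w) = y (word_star u @ w)"
    using assms(2) by (auto simp: canonical_vectors_def)
  have "qwords (d - 1) \<subseteq> qwords d"
    by (auto simp: qwords_def)
  then obtain B where B: "finite B" "rindep B" "rspan B = rspan (v ` qwords (d - 1))" "card B = r"
    using qrank_gram[of "qwords (d - 1)" "moment_matrix y" v] assms(1) gram finite_qwords
    unfolding moment_matrix_def by (metis subsetD)
  have "rspan B = UNIV"
    using rspan_UNIV_if_rdim[OF _ v(1) B(1,2)] v(2) B(4) finite_qwords by auto
  then show ?thesis
    using B(3) by simp
qed

text \<open>Well-definedness of the shift. X is prescribed only on a basis chosen among the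
  \<open>v w\<close>. For the other words it is tested against the spanning vectors
  \<open>v u\<close>: by \<open>move\<close>, prepending a to w amounts to prepending the starred
  letter to u, an expression linear in \<open>v w\<close>.\<close>

lemma shift_op_apply:
  fixes v :: "'n::finite qword \<Rightarrow> 'h::rquat_inner"
  assumes d: "d \<ge> 1" and span: "rspan (v ` qwords (d - 1)) = UNIV"
    and gram: "\<And>u w. u \<in> qwords d \<Longrightarrow> w \<in> qwords d \<Longrightarrow> qinner (v u) (v w) = y (word_star u @ w)"
    and w: "w \<in> qwords (d - 1)"
  shows "qapply (shift_op d v a) (v w) = v (a # w)"
proof -
  have Cons_mem: "b # u \<in> qwords d" and mem: "u \<in> qwords d" if "u \<in> qwords (d - 1)" for b u
    using that d by (auto simp: qwords_def)
  \<comment> \<open>Both sides are y at the same word. The bound d - 1 leaves room for one more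
    letter, so \<open>gram\<close> covers both.\<close>
  have move: "qinner (v u) (v (a # w)) = qinner (v (letter_star a # u)) (v w)"
    if "u \<in> qwords (d - 1)" "w \<in> qwords (d - 1)" for u w
    using that by (simp add: gram Cons_mem mem word_star_Cons)
  obtain B where B: "B \<subseteq> v ` qwords (d - 1)" "finite B" "rindep B" "rspan B = UNIV"
    using rbasis_exists[of "v ` qwords (d - 1)"] span finite_qwords by (metis finite_imageI)
  have "\<exists>u. b \<in> B \<longrightarrow> u \<in> qwords (d - 1) \<and> b = v u" for b
    using B(1) by blast
  then obtain word where word: "\<And>b. b \<in> B \<Longrightarrow> word b \<in> qwords (d - 1)" "\<And>b. b \<in> B \<Longrightarrow> b = v (word b)"
    by metis
  obtain X where X: "\<And>b. b \<in> B \<Longrightarrow> qapply X b = v (a # word b)"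
    using qop_extend[OF B(2-4), of "\<lambda>b. v (a # word b)"] by metis
  have X_apply: "qapply X (v w) = v (a # w)" if w: "w \<in> qwords (d - 1)" for w
  proof (rule qinner_eqI_on_span[OF span])
    fix x assume "x \<in> v ` qwords (d - 1)"
    then obtain u where u: "u \<in> qwords (d - 1)" "x = v u"
      by blast
    let ?z = "v (letter_star a # u)"
    have "b \<in> {z. qinner ?z z = qinner x (qapply X z)}" if b: "b \<in> B" for b
    proof -
      have "qinner x (qapply X b) = qinner ?z (v (word b))"
        using X[OF b] move[OF u(1) word(1)[OF b]] u(2) by simp
      then show ?thesis
        using word(2)[OF b] by simp
    qed
    then have "rspan B \<subseteq> {z. qinner ?z z = qinner x (qapply X z)}"
      by (intro rspan_minimal rsubspace_qinner_right_eq) (auto simp: qapply_add qapply_scale)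
    then have "v w \<in> {z. qinner ?z z = qinner x (qapply X z)}"
      using B(4) by blast
    then show "qinner x (qapply X (v w)) = qinner x (v (a # w))"
      using move[OF u(1) w] u(2) by simp
  qed
  have "shift_op d v a = X"
    unfolding shift_op_def
  proof (rule the_equality)
    show "X' = X" if "\<forall>w\<in>qwords (d - 1). qapply X' (v w) = v (a # w)" for X'
      using that X_apply by (intro qop_eqI_on_span[OF span]) auto
  qed (use X_apply in blast)
  then show ?thesis
    using X_apply w by simp
qed

text \<open>For words u and w both inner products are y at the concatenation of the reversed star of
  u, the starred letter and w. Linearity extends this first in the left argument, then in the
  right.\<close>

lemma shift_op_adjoint:
  fixes v :: "'n::finite qword \<Rightarrow> 'h::rquat_inner"
  assumes d: "d \<ge> 1" and span: "rspan (v ` qwords (d - 1)) = UNIV"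
    and gram: "\<And>u w. u \<in> qwords d \<Longrightarrow> w \<in> qwords d \<Longrightarrow> qinner (v u) (v w) = y (word_star u @ w)"
  shows "adjoint_pair (shift_op d v a) (shift_op d v (letter_star a))"
proof -
  let ?A = "shift_op d v a" and ?A' = "shift_op d v (letter_star a)"
  have mem: "b # u \<in> qwords d" "u \<in> qwords d" if "u \<in> qwords (d - 1)" for b u
    using that d by (auto simp: qwords_def)
  note X = shift_op_apply[where y = y, OF d span gram]
  have words: "qinner (qapply ?A (v u)) (v w) = qinner (v u) (qapply ?A' (v w))"
    if "u \<in> qwords (d - 1)" "w \<in> qwords (d - 1)" for u w
    using that by (simp add: X gram mem word_star_Cons)
  have left: "qinner (qapply ?A x) (v w) = qinner x (qapply ?A' (v w))" if w: "w \<in> qwords (d - 1)" for x w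
  proof -
    have "rspan (v ` qwords (d - 1)) \<subseteq> {x. qinner (qapply ?A x) (v w) = qinner x (qapply ?A' (v w))}"
      using words w by (intro rspan_minimal rsubspace_qinner_eq) (auto simp: qapply_add qapply_scale)
    then show ?thesis
      using span by auto
  qed
  have "qinner (qapply ?A x) z = qinner x (qapply ?A' z)" for x z
  proof -
    have "rspan (v ` qwords (d - 1)) \<subseteq> {z. qinner (qapply ?A x) z = qinner x (qapply ?A' z)}"
      using left by (intro rspan_minimal rsubspace_qinner_right_eq) (auto simp: qapply_add qapply_scale)
    then show ?thesis
      using span by auto
  qed
  then show ?thesis
    by (simp add: adjoint_pair_def)
qed

section \<open>Commutation tests on letters and on a basis\<close>

lemma fa_eval_commute:
  fixes X :: "'n letter \<Rightarrow> 'b::{real_algebra, monoid_mult}"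
  assumes "\<And>a. C * X a = X a * C"
  shows "C * fa_eval X p = fa_eval X p * C"
proof -
  have "C * prod_list (map X w) = prod_list (map X w) * C" for w
  proof (induction w)
    case (Cons a w)
    have "C * (X a * prod_list (map X w)) = X a * (C * prod_list (map X w))"
      by (simp add: assms flip: mult.assoc)
    then show ?case
      by (simp add: Cons mult.assoc)
  qed simp
  then show ?thesis
    by (simp add: fa_eval_def sum_distrib_left sum_distrib_right)
qed

lemma subspace_commutant: "subspace {B. C * B = B * C}" for C :: "'b::real_algebra"
  by (rule subspaceI) (simp_all add: distrib_left distrib_right)

lemma commute_span:
  fixes C :: "'b::real_algebra"
  assumes "\<And>B. B \<in> S \<Longrightarrow> C * B = B * C" "B \<in> span S"
  shows "C * B = B * C"
  using span_minimal[OF _ subspace_commutant, of S C] assms by blast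

text \<open>A \<mapsto> \<open>A + st A\<close> is real-linear with values in \<open>Sym\<close>, so
  the test on S extends to all of R; on a symmetric A the map is doubling, and the factor 2
  cancels.\<close>

lemma (in positive_star_algebra) Sym_central_iff_basis:
  assumes "span S = R"
  shows "(\<forall>A\<in>Sym. \<forall>B\<in>R. A * B = B * A) \<longleftrightarrow>
    (\<forall>A\<in>S. \<forall>B\<in>S. (A + st A) * B = B * (A + st A))"
proof (intro iffI ballI)
  fix A B assume *: "\<forall>A\<in>Sym. \<forall>B\<in>R. A * B = B * A" and "A \<in> S" "B \<in> S"
  then have AB: "A \<in> R" "B \<in> R"
    using assms span_base by blast+
  then have "A + st A \<in> Sym"
    by (simp add: Sym_def add_mem st_mem st_add st_st add.commute)
  then show "(A + st A) * B = B * (A + st A)"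
    using * AB by blast
next
  fix A B assume *: "\<forall>A\<in>S. \<forall>B\<in>S. (A + st A) * B = B * (A + st A)" and A: "A \<in> Sym" and B: "B \<in> R"
  have S: "S \<subseteq> R"
    using assms span_base by blast
  have "subspace {A \<in> R. (A + st A) * B = B * (A + st A)}"
    by (rule subspaceI)
       (simp_all add: zero_mem add_mem scaleR_mem st_zero st_add st_scaleR distrib_left distrib_right
          algebra_simps flip: scaleR_add_right)
  moreover have "S \<subseteq> {A \<in> R. (A + st A) * B = B * (A + st A)}"
    using S commute_span[of S] * B assms by blast
  ultimately have "span S \<subseteq> {A \<in> R. (A + st A) * B = B * (A + st A)}"
    by (intro span_minimal)
  then have "(A + A) * B = B * (A + A)"
    using A assms by (auto simp: Sym_def)
  then have "2 *\<^sub>R (A * B) = 2 *\<^sub>R (B * A)"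
    by (simp add: scaleR_2 distrib_left distrib_right)
  then show "A * B = B * A"
    by simp
qed

lemma real_basis_exists:
  fixes R :: "'a::real_vector set"
  assumes "subspace R" "finite Bs" "R \<subseteq> span Bs"
  shows "\<exists>s F. real_basis s F R"
proof -
  obtain C where C: "finite C" "C \<subseteq> R" "independent C" "R \<subseteq> span C"
    using finite_span_basis[OF assms(2,3)] by metis
  obtain F where "bij_betw F {1..card C} C"
    using ex_bij_betw_nat_finite_1[OF C(1)] by blast
  then have "real_basis (card C) F R"
    using C span_minimal[OF C(2) assms(1)] by (auto simp: real_basis_def bij_betw_def)
  then show ?thesis
    by blast
qed

theorem proposition5p14:
  fixes d r :: nat
    and y :: "'n::finite qword \<Rightarrow> quat"
    and v :: "'n qword \<Rightarrow> 'h::rquat_inner"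
    and \<pi> :: "'n free_alg \<Rightarrow> 'h qop"
    and R :: "'h qop set"
  assumes "d \<ge> 1"
    and "pseudo_moments d y"
    and "y [] = 1"
    and "qpsd (qwords d) (moment_matrix y)"
    and "qrank (qwords d) (moment_matrix y) = r"
    and "qrank (qwords (d - 1)) (moment_matrix y) = r"
    and "canonical_vectors d r y v"
    and "\<pi> = flat_rep d v"
    and "R = range \<pi>"
  shows
    "(\<forall>s F. real_basis s F R \<longrightarrow>
        ((\<pi> ` vanishing_ideal = {0}) \<longleftrightarrow> sym_part R \<subseteq> ring_center R) \<and>
        (sym_part R \<subseteq> ring_center R \<longleftrightarrow>
          (\<forall>a\<in>{1..s}. \<forall>b\<in>{1..s}. ring_commutator (F a + qadj (F a)) (F b) = 0)) \<and>
        ((\<forall>a\<in>{1..s}. \<forall>b\<in>{1..s}. ring_commutator (F a + qadj (F a)) (F b) = 0) \<longleftrightarrow>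
          (\<forall>a\<in>{1..s}. \<forall>i. ring_commutator (F a + qadj (F a)) (\<pi> (fa_gen (Lq i))) = 0)) \<and>
        s \<le> dim (UNIV :: 'h qop set)) \<and>
     (\<exists>s F. real_basis s F R \<and>
        ((\<pi> ` vanishing_ideal = {0}) \<longleftrightarrow>
          (\<forall>a\<in>{1..s}. \<forall>i. ring_commutator (F a + qadj (F a)) (\<pi> (fa_gen (Lq i))) = 0))) \<and>
     dim (UNIV :: 'h qop set) = 4 * r\<^sup>2"
proof -
  let ?X = "shift_op d v"
  have v: "rspan (v ` qwords d) = UNIV" "rdim (UNIV :: 'h set) = r"
    and gram: "\<And>u w. u \<in> qwords d \<Longrightarrow> w \<in> qwords d \<Longrightarrow> qinner (v u) (v w) = y (word_star u @ w)"
    using assms(7) by (auto simp: canonical_vectors_def)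
  have X_adj: "adjoint_pair (?X a) (?X (letter_star a))" for a
    by (rule shift_op_adjoint[OF assms(1) flat_span[OF assms(6,7)] gram])
  have pi: "\<pi> p = fa_eval ?X p" for p
    by (simp add: assms(8) flat_rep_def)
  have pi_adj: "adjoint_pair (\<pi> p) (\<pi> (free_alg_star p))" for p
    unfolding pi
    by (rule fa_eval_star_rel)
       (simp_all add: adjoint_pair_zero adjoint_pair_one adjoint_pair_add adjoint_pair_scaleR
          adjoint_pair_mult X_adj)
  have pi_qadj: "qadj (\<pi> p) = \<pi> (free_alg_star p)" for p
    by (rule qadj_eq[OF pi_adj])
  have pi_gen: "\<pi> (fa_gen a) = ?X a" for a
    by (simp add: pi fa_gen_def fa_eval_single)
  have pi_scale: "c *\<^sub>R \<pi> p = \<pi> (Poly_Mapping.single [] c * p)" for c p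
    by (simp add: pi fa_eval_mult fa_eval_single)
  \<comment> \<open>Every element of R has an adjoint, given by the starred polynomial, so
    \<open>qadj\<close> is never a junk value on R and the star laws follow from those of
    \<open>adjoint_pair\<close>.\<close>
  have adj: "adjoint_pair A (qadj A)" if "A \<in> R" for A
    using that pi_adj by (auto simp: assms(9) pi_qadj)
  have R_subspace: "subspace R"
    unfolding assms(9)
  proof (rule subspaceI)
    show "0 \<in> range \<pi>"
      by (rule range_eqI[of _ _ 0]) (simp add: pi)
    show "A + B \<in> range \<pi>" if "A \<in> range \<pi>" "B \<in> range \<pi>" for A B
      using that by (auto simp: pi simp flip: fa_eval_add)
    show "c *\<^sub>R A \<in> range \<pi>" if "A \<in> range \<pi>" for c A
      using that by (auto simp: pi_scale)
  qed
  obtain B where B: "finite B" "rindep B" "rspan B = rspan (v ` qwords d)"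
    using rbasis_exists[of "v ` qwords d"] finite_qwords by (metis finite_imageI)
  have B_span: "rspan B = UNIV"
    using B(3) v(1) by simp
  have "rspan (UNIV :: 'h set) = UNIV"
    using rspan_base by blast
  then have "card B = r"
    using rdim_eq_card[OF B(1,2), of UNIV] B_span v(2) by simp
  then have dim: "dim (UNIV :: 'h qop set) = 4 * r\<^sup>2"
    using qop_dim(1)[OF B(1,2) B_span] by simp
  obtain Bs :: "'h qop set" where Bs: "finite Bs" "span Bs = UNIV"
    using qop_dim(2)[OF B(1,2) B_span] by blast
  interpret positive_star_algebra R qadj Bs
  proof
    show "1 \<in> R"
      unfolding assms(9) by (rule range_eqI[of _ _ "Poly_Mapping.single [] 1"]) (simp add: pi fa_eval_single)
    show "A * B \<in> R" if "A \<in> R" "B \<in> R" for A B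
      using that by (auto simp: assms(9) pi simp flip: fa_eval_mult)
    show "qadj A \<in> R" if "A \<in> R" for A
      using that by (auto simp: assms(9) pi_qadj)
    show "qadj (A + B) = qadj A + qadj B" if "A \<in> R" "B \<in> R" for A B
      by (intro qadj_eq adjoint_pair_add adj that)
    show "qadj (c *\<^sub>R A) = c *\<^sub>R qadj A" if "A \<in> R" for A c
      by (intro qadj_eq adjoint_pair_scaleR adj that)
    show "qadj (qadj A) = A" if "A \<in> R" for A
      by (intro qadj_eq adjoint_pair_sym[OF adj] that)
    show "qadj (A * B) = qadj B * qadj A" if "A \<in> R" "B \<in> R" for A B
      by (intro qadj_eq adjoint_pair_mult adj that)
    show "A = 0" if "A \<in> R" "B \<in> R" "qadj A * A + qadj B * B = 0" for A B
      using adjoint_pair_definite[OF adj adj] that by blast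
  qed (use Bs R_subspace in auto)
  have Sym: "sym_part R = Sym"
    by (simp add: sym_part_def Sym_def)
  have ii: "sym_part R \<subseteq> ring_center R \<longleftrightarrow> (\<forall>A\<in>Sym. \<forall>B\<in>R. A * B = B * A)"
    unfolding Sym by (auto simp: ring_center_def Sym_def)
  have X_mem: "?X a \<in> R" for a
    by (simp add: assms(9) flip: pi_gen)
  have i_ii: "\<pi> ` vanishing_ideal = {0} \<longleftrightarrow> sym_part R \<subseteq> ring_center R"
  proof
    assume zero: "\<pi> ` vanishing_ideal = {0}"
    show "sym_part R \<subseteq> ring_center R"
      unfolding ii
    proof (intro ballI)
      fix A B assume A: "A \<in> Sym" and B: "B \<in> R"
      then have "A \<in> range \<pi>" "B \<in> range \<pi>"
        by (simp_all add: Sym_def flip: assms(9))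
      then obtain p q where pq: "A = \<pi> p" "B = \<pi> q"
        by blast
      have star: "\<pi> (free_alg_star p) = A"
        using A pq(1) by (simp add: Sym_def flip: pi_qadj)
      \<comment> \<open>Both p and its star map to A, so the image of this element of the ideal is
        twice the commutator of A and B.\<close>
      have "\<pi> ((p + free_alg_star p) * q - q * (p + free_alg_star p)) = 0"
        using zero symmetrized_commutator_vanishing by blast
      then have "2 *\<^sub>R (A * B) = 2 *\<^sub>R (B * A)"
        using star pq by (simp add: pi fa_eval_diff fa_eval_mult fa_eval_add scaleR_2 distrib_left distrib_right)
      then show "A * B = B * A"
        by simp
    qed
  next
    assume center: "sym_part R \<subseteq> ring_center R"
    interpret central_star_algebra R qadj Bs
      by unfold_locales (use center in \<open>auto simp: ii Sym_def\<close>)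
    have "\<pi> p = 0" if "p \<in> vanishing_ideal" for p
      unfolding pi
    proof (rule fa_eval_vanishing_ideal[OF X_mem _ _ that])
      show "?X (letter_star a) = qadj (?X a)" for a
        by (rule qadj_eq[OF X_adj, symmetric])
      show "fa_eval ?X p \<in> R"
        by (simp add: assms(9) flip: pi)
    qed
    moreover have "0 \<in> vanishing_ideal"
      by (simp add: vanishing_ideal_def)
    ultimately show "\<pi> ` vanishing_ideal = {0}"
      by (auto simp: image_iff intro!: bexI[of _ 0])
  qed
  have ii_iii: "sym_part R \<subseteq> ring_center R \<longleftrightarrow>
      (\<forall>a\<in>{1..s}. \<forall>b\<in>{1..s}. ring_commutator (F a + qadj (F a)) (F b) = 0)"
    if "real_basis s F R" for s F
    using Sym_central_iff_basis[of "F ` {1..s}"] that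
    by (simp add: ii real_basis_def ring_commutator_def)
  have iii_iv: "(\<forall>a\<in>{1..s}. \<forall>b\<in>{1..s}. ring_commutator (F a + qadj (F a)) (F b) = 0) \<longleftrightarrow>
      (\<forall>a\<in>{1..s}. \<forall>i. ring_commutator (F a + qadj (F a)) (\<pi> (fa_gen (Lq i))) = 0)"
    if "real_basis s F R" for s F
  proof -
    have span: "span (F ` {1..s}) = R"
      using that by (simp add: real_basis_def)
    have F_mem: "F a \<in> R" if "a \<in> {1..s}" for a
      using span_base[of "F a" "F ` {1..s}"] that span by blast
    \<comment> \<open>The two conditions are compared for one fixed symmetric C, to be instantiated
      with each symmetrized basis element.\<close>
    have "(\<forall>b\<in>{1..s}. C * F b = F b * C) \<longleftrightarrow> (\<forall>i. C * ?X (Lq i) = ?X (Lq i) * C)"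
      if C: "C \<in> Sym" for C
    proof
      assume "\<forall>b\<in>{1..s}. C * F b = F b * C"
      then show "\<forall>i. C * ?X (Lq i) = ?X (Lq i) * C"
        using commute_span[of "F ` {1..s}" C] X_mem span by blast
    next
      assume comm: "\<forall>i. C * ?X (Lq i) = ?X (Lq i) * C"
      have CR: "C \<in> R" "qadj C = C"
        using C by (auto simp: Sym_def)
      have "C * ?X a = ?X a * C" for a
      proof (cases a)
        case (Lqbar i)
        \<comment> \<open>Taking adjoints turns commutation of C with the operator of q_i into
          commutation with that of its conjugate letter, because C is symmetric.\<close>
        have "qadj (C * ?X (Lq i)) = qadj (?X (Lq i) * C)"
          using comm by simp
        moreover have "qadj (?X (Lq i)) = ?X (Lqbar i)"
          using qadj_eq[OF X_adj, of "Lq i"] by simp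
        ultimately show ?thesis
          using Lqbar CR X_mem by (simp add: st_mult)
      qed (use comm in simp)
      then have "C * \<pi> p = \<pi> p * C" for p
        unfolding pi by (rule fa_eval_commute)
      then have C_R: "C * A = A * C" if "A \<in> R" for A
        using that unfolding assms(9) by (elim rangeE) simp
      show "\<forall>b\<in>{1..s}. C * F b = F b * C"
        by (intro ballI C_R F_mem)
    qed
    moreover have "F a + qadj (F a) \<in> Sym" if "a \<in> {1..s}" for a
      using F_mem[OF that] by (simp add: Sym_def add_mem st_mem st_add st_st add.commute)
    ultimately show ?thesis
      by (simp add: ring_commutator_def pi_gen)
  qed
  have s_le: "s \<le> dim (UNIV :: 'h qop set)" if "real_basis s F R" for s F
  proof -
    obtain C :: "'h qop set" where "finite C" "UNIV \<subseteq> span C" "card C = dim (UNIV :: 'h qop set)"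
      using finite_span_basis[OF Bs(1), of UNIV] Bs(2) by (metis order_refl)
    then have "card (F ` {1..s}) \<le> dim (UNIV :: 'h qop set)"
      using independent_span_bound[of C "F ` {1..s}"] that by (auto simp: real_basis_def)
    then show ?thesis
      using that by (simp add: real_basis_def card_image)
  qed
  obtain s F where basis: "real_basis s F R"
    using real_basis_exists[OF R_subspace Bs(1)] Bs(2) by auto
  show ?thesis
  proof (intro conjI allI impI)
    show "\<exists>s F. real_basis s F R \<and> (\<pi> ` vanishing_ideal = {0} \<longleftrightarrow>
        (\<forall>a\<in>{1..s}. \<forall>i. ring_commutator (F a + qadj (F a)) (\<pi> (fa_gen (Lq i))) = 0))"
      using basis i_ii ii_iii[OF basis] iii_iv[OF basis] by metis
  qed (assumption | rule i_ii ii_iii iii_iv s_le dim)+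
qed

end
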